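(* Let $F\in\mathbb{Q}[X,Y,Z]$ be a square-free homogeneous polynomial of positive degree with integer coefficients. Let $q$ be a prime number such that the reduction $F_q\in\mathbb{F}_q[X,Y,Z]$ of $F$ modulo $q$ is non-zero. Consider the curves $\Gamma=\operatorname{Proj}(\mathbb{Q}[X,Y,Z]/\langle F\rangle)$ and $\Gamma_q=\operatorname{Proj}(\mathbb{F}_q[X,Y,Z]/\langle F_q\rangle)$, and let $P=\langle X,Y\rangle$. Suppose that $$\tau_P(\Gamma_q)=\tau_P(\Gamma)>0\quad\text{and}\quad \tau_{X\neq 0}(\Gamma_q)=\tau_{Y\neq 0}(\Gamma_q)=0.$$ Then $\Gamma_{\mathrm{sing}}=\{P\}$.
   Context: For a field $L$ and a non-zero homogeneous polynomial $F\in L[X,Y,Z]$ of positive degree, let $\Gamma=\operatorname{Proj}(L[X,Y,Z]/\langle F\rangle)$. With $F_X,F_Y,F_Z$ the partial derivatives of $F$, the singular locus of $\Gamma$ (for $L=\mathbb{Q}$ and $F$ square-free) is $\Gamma_{\mathrm{sing}}=\operatorname{Proj}(L[X,Y,Z]/\langle F_X,F_Y,F_Z\rangle)\subset\Gamma$, regarded as a set of points. The point $P=\langle X,Y\rangle$ is the point $(0:0:1)$. The Tjurina number of $\Gamma$ at $P$ is $$\tau_P(\Gamma)=\dim_L\left(L[X,Y]_{\langle X,Y\rangle}/\langle f,f_X,f_Y\rangle\right),\qquad f=F(X,Y,1).$$ The Tjurina number of $\Gamma$ in the chart $X\neq 0$ is $$\tau_{X\neq0}(\Gamma)=\dim_L\left(L[Y,Z]/\langle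 h,h_Y,h_Z\rangle\right),\qquad h=F(1,Y,Z),$$ and $\tau_{Y\neq 0}(\Gamma)$ is defined analogously using $F(X,1,Z)\in L[X,Z]$. Subscripts on $f,h$ denote partial derivatives. For $\Gamma_q$ these are taken with $L=\mathbb{F}_q$ and $F_q$ in place of $F$. *)

theory Defs
  imports
    "HOL-Algebra.Algebraic_Closure_Type"
    "HOL-Algebra.Embedded_Algebras"
    "HOL-Algebra.QuotRing"
    "HOL-Library.Extended_Nat"
begin

text \<open>
  Polynomials in several variables are iterated univariate ones: \<open>L[X,Y,Z]\<close> is
  \<open>'a poly poly poly\<close>, read as \<open>L[X][Y][Z]\<close> (the outermost variable is \<open>Z\<close>), and likewise
  \<open>'a poly poly\<close> is \<open>L[U][V]\<close> with outermost variable \<open>V\<close>.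
  Thus \<open>coeff (coeff (coeff F k) j) i\<close> is the coefficient of \<open>X^i Y^j Z^k\<close>.
\<close>

type_synonym 'a poly3 = "'a poly poly poly"

definition varX :: "'a::comm_ring_1 poly3" where "varX = [:[:[:0, 1:]:]:]"
definition varY :: "'a::comm_ring_1 poly3" where "varY = [:[:0, 1:]:]"
definition varZ :: "'a::comm_ring_1 poly3" where "varZ = [:0, 1:]"

definition partialX :: "'a::field poly3 \<Rightarrow> 'a poly3" where
  "partialX F = map_poly (map_poly pderiv) F"
definition partialY :: "'a::field poly3 \<Rightarrow> 'a poly3" where
  "partialY F = map_poly pderiv F"
definition partialZ :: "'a::field poly3 \<Rightarrow> 'a poly3" where
  "partialZ F = pderiv F"

definition homogeneous :: "nat \<Rightarrow> 'a::zero poly3 \<Rightarrow> bool" where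
  "homogeneous d F \<longleftrightarrow>
     (\<forall>i j k. coeff (coeff (coeff F k) j) i \<noteq> 0 \<longrightarrow> i + j + k = d)"

definition map_coeffs :: "('a::zero \<Rightarrow> 'b::zero) \<Rightarrow> 'a poly3 \<Rightarrow> 'b poly3" where
  "map_coeffs \<phi> F = map_poly (map_poly (map_poly \<phi>)) F"

definition polyring3 :: "'a::field poly3 ring" where
  "polyring3 = ring_of_type_algebra"

definition homogeneous_ideal :: "'a::field poly3 set \<Rightarrow> bool" where
  "homogeneous_ideal I \<longleftrightarrow>
     ideal I polyring3 \<and> I = genideal polyring3 {a \<in> I. \<exists>d. homogeneous d a}"

text \<open>
  The points of \<open>Proj(L[X,Y,Z]/J)\<close>, for \<open>J\<close> a homogeneous ideal, are represented by their preimages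
  in \<open>L[X,Y,Z]\<close>, i.e. as points of the projective plane: the homogeneous prime ideals that
  contain \<open>J\<close> but not the irrelevant ideal \<open>\<langle>X,Y,Z\<rangle>\<close>.
\<close>

definition Proj_quot :: "'a::field poly3 set \<Rightarrow> 'a poly3 set set" where
  "Proj_quot J = {\<pp>. primeideal \<pp> polyring3 \<and> homogeneous_ideal \<pp> \<and> J \<subseteq> \<pp> \<and>
                      \<not> genideal polyring3 {varX, varY, varZ} \<subseteq> \<pp>}"

definition singular_locus :: "'a::field poly3 \<Rightarrow> 'a poly3 set set" where
  "singular_locus F =
     Proj_quot (genideal polyring3 {partialX F, partialY F, partialZ F})"

definition point_P :: "'a::field poly3 set" where
  "point_P = genideal polyring3 {varX, varY}"

text \<open>
  The dimension of \<open>R/I\<close> over a field mapping to \<open>R\<close> by \<open>\<kappa>\<close>. Scalars act through their classes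
  in \<open>R/I\<close>. If \<open>R/I\<close> is the zero ring, the image of \<open>\<kappa>\<close> is not a field, but
  \<^const>\<open>ring.dimension\<close> still holds for exactly one number, namely \<open>0\<close>.
\<close>

definition quotient_dim :: "('r, 'm) ring_scheme \<Rightarrow> ('k::field \<Rightarrow> 'r) \<Rightarrow> 'r set \<Rightarrow> enat" where
  "quotient_dim R \<kappa> I =
     (let Q = R Quot I; K = range (\<lambda>c. I +>\<^bsub>R\<^esub> \<kappa> c)
      in if ring.finite_dimension Q K (carrier Q)
         then enat (ring.dim Q K (carrier Q)) else \<infinity>)"

definition affine_tjurina :: "'a::field poly poly \<Rightarrow> enat" where
  "affine_tjurina h =
     (let R = ring_of_type_algebra :: 'a poly poly ring
      in quotient_dim R (\<lambda>c. [:[:c:]:]) (genideal R {h, map_poly pderiv h, pderiv h}))"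

text \<open>
  The localization of \<open>L[U,V]\<close> at \<open>\<langle>U,V\<rangle>\<close>, as a subring of \<open>L(U,V)\<close>: the prime ideal \<open>\<langle>U,V\<rangle>\<close>
  consists of the polynomials that vanish at the origin.
\<close>

definition local_ring_origin :: "'a::field poly poly fract ring" where
  "local_ring_origin =
     ring_of_type_algebra \<lparr>carrier := {Fract a b | a b. poly (poly b 0) 0 \<noteq> 0}\<rparr>"

definition local_tjurina :: "'a::field poly poly \<Rightarrow> enat" where
  "local_tjurina f =
     quotient_dim local_ring_origin (\<lambda>c. to_fract [:[:c:]:])
       (genideal local_ring_origin
          {to_fract f, to_fract (map_poly pderiv f), to_fract (pderiv f)})"

definition tjurina_P :: "'a::field poly3 \<Rightarrow> enat" where
  "tjurina_P F = local_tjurina (poly F 1)"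

definition tjurina_X_nonzero :: "'a::field poly3 \<Rightarrow> enat" where
  "tjurina_X_nonzero F = affine_tjurina (map_poly (map_poly (\<lambda>c. poly c 1)) F)"

definition tjurina_Y_nonzero :: "'a::field poly3 \<Rightarrow> enat" where
  "tjurina_Y_nonzero F = affine_tjurina (map_poly (\<lambda>c. poly c 1) F)"

end

theory Submission
  imports Defs "HOL-Number_Theory.Residues"
begin

text \<open>
  The argument compares two numbers in each large degree \<open>n\<close>. Let \<open>S\<^sub>n\<close> be the space of ternary forms
  of degree \<open>n\<close> over a field, and let \<open>J\<^sub>n\<close> consist of its elements that lie in the ideal generated by
  \<open>F\<close> and its partial derivatives (\<open>jacobian_forms\<close>). Setting \<open>Z = 1\<close> maps \<open>S\<^sub>n / J\<^sub>n\<close> to the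
  local Tjurina algebra at \<open>P\<close>, whose dimension is \<open>\<tau>\<close>.

  Over the prime field, a vanishing Tjurina number in the chart \<open>X \<noteq> 0\<close> means that \<open>1\<close> is a
  combination of the dehomogenized generators, so a power of \<open>X\<close> lies in the ideal; likewise a power of \<open>Y\<close>. Therefore
  the local Tjurina algebra is finite-dimensional, it coincides with the affine one of the chart
  \<open>Z \<noteq> 0\<close>, and for large \<open>n\<close> the map from \<open>S\<^sub>n / J\<^sub>n\<close> to it is injective. So \<open>J\<^sub>n\<close> has codimension
  at most \<open>\<tau>\<close> in \<open>S\<^sub>n\<close> (\<open>codimension_jacobian_forms_le\<close>).

  Over the rationals, \<open>\<tau>\<close> is the same number by hypothesis, and it is finite. Every element of the
  local Tjurina algebra is then represented by a polynomial, hence, for large \<open>n\<close>, by a form of degree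
  \<open>n\<close>. So the kernel \<open>K\<^sub>n\<close> of \<open>S\<^sub>n\<close> onto the local algebra has codimension at least \<open>\<tau>\<close>
  (\<open>codimension_local_jacobian_forms_ge\<close>).

  The two fields are related by semicontinuity of rank: integral forms whose reductions are linearly
  independent are linearly independent over the rationals, so the dimension of \<open>J\<^sub>n\<close> over the rationals
  is at least its dimension over the prime field (\<open>independent_jacobian_forms_lift\<close>). Since \<open>S\<^sub>n\<close> has the same
  dimension over both fields and \<open>J\<^sub>n \<subseteq> K\<^sub>n\<close>, the counts force \<open>J\<^sub>n = K\<^sub>n\<close> over the rationals
  (\<open>codimension_squeeze\<close>). As \<open>K\<^sub>n\<close> contains \<open>X^n\<close> and \<open>Y^n\<close> for \<open>n \<ge> \<tau>\<close>, every homogeneous prime that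
  contains the partial derivatives of \<open>F\<close> contains \<open>X\<close> and \<open>Y\<close>, and \<open>P\<close> is the only such point of
  the plane. Conversely \<open>\<tau> > 0\<close> makes all three partial derivatives vanish at \<open>P\<close>.
\<close>

section \<open>Subrings of a commutative ring type\<close>

abbreviation ring_on :: "'r::comm_ring_1 set \<Rightarrow> 'r ring" where
  "ring_on C \<equiv> ring_of_type_algebra\<lparr>carrier := C\<rparr>"

lemma ring_of_type_algebra_sel [simp]:
  "carrier ring_of_type_algebra = UNIV"
  "x \<otimes>\<^bsub>ring_of_type_algebra\<^esub> y = x * y" "x \<oplus>\<^bsub>ring_of_type_algebra\<^esub> y = x + y"
  "\<one>\<^bsub>ring_of_type_algebra\<^esub> = 1" "\<zero>\<^bsub>ring_of_type_algebra\<^esub> = 0"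
  by (simp_all add: ring_of_type_algebra_def)

lemma ring_on_sel [simp]:
  "carrier (ring_on C) = C"
  "x \<otimes>\<^bsub>ring_on C\<^esub> y = x * y" "x \<oplus>\<^bsub>ring_on C\<^esub> y = x + y"
  "\<one>\<^bsub>ring_on C\<^esub> = 1" "\<zero>\<^bsub>ring_on C\<^esub> = 0"
  by (simp_all add: ring_of_type_algebra_def)

lemma ring_on_UNIV: "ring_on UNIV = ring_of_type_algebra"
  by (simp add: ring_of_type_algebra_def)

text \<open>
  Both the polynomial rings and the local ring are subsets of a type that carries the ring operations,
  which allows ideals and quotients to be handled with the operations of the type.
\<close>

locale type_subring =
  fixes C :: "'r::comm_ring_1 set"
  assumes zero_mem: "0 \<in> C" and one_mem: "1 \<in> C"
    and add_mem: "\<And>x y. x \<in> C \<Longrightarrow> y \<in> C \<Longrightarrow> x + y \<in> C"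
    and uminus_mem: "\<And>x. x \<in> C \<Longrightarrow> - x \<in> C"
    and mult_mem: "\<And>x y. x \<in> C \<Longrightarrow> y \<in> C \<Longrightarrow> x * y \<in> C"
begin

lemma cring_ring_on: "cring (ring_on C)"
proof -
  have "\<exists>y\<in>C. y + x = 0 \<and> x + y = 0" if "x \<in> C" for x
    using uminus_mem[OF that] by (intro bexI[of _ "- x"]) auto
  then show ?thesis
    by unfold_locales
      (auto simp: Units_def algebra_simps zero_mem one_mem add_mem mult_mem)
qed

sublocale cring "ring_on C" by (rule cring_ring_on)

lemma a_minus_eq: "x \<in> C \<Longrightarrow> \<ominus>\<^bsub>ring_on C\<^esub> x = - x"
  by (metis add.inv_closed add.inv_equality a_inv_def add_eq_0_iff ring_on_sel(1,3,5) 
      uminus_mem left_minus minus_equality)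

lemma ideal_ring_onI:
  assumes "I \<subseteq> C" "0 \<in> I" "\<And>x y. x \<in> I \<Longrightarrow> y \<in> I \<Longrightarrow> x + y \<in> I"
    "\<And>x a. x \<in> I \<Longrightarrow> a \<in> C \<Longrightarrow> a * x \<in> I"
  shows "ideal I (ring_on C)"
proof (rule idealI[OF ring_axioms])
  have "- x \<in> I" if "x \<in> I" for x
    using assms(4)[OF that, of "-1"] uminus_mem[OF one_mem] by simp
  then show "subgroup I (add_monoid (ring_on C))"
    using assms by (intro add.subgroupI) (auto simp: a_minus_eq simp flip: a_inv_def)
qed (use assms(4) in \<open>auto simp: mult.commute\<close>)

lemma ideal_closed:
  assumes "ideal I (ring_on C)"
  shows "I \<subseteq> C" "0 \<in> I" "\<And>x y. x \<in> I \<Longrightarrow> y \<in> I \<Longrightarrow> x + y \<in> I"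
    "\<And>x a. x \<in> I \<Longrightarrow> a \<in> C \<Longrightarrow> a * x \<in> I"
    "\<And>x y. x \<in> I \<Longrightarrow> y \<in> I \<Longrightarrow> x - y \<in> I"
proof -
  interpret I: ideal I "ring_on C" by fact
  show sub: "I \<subseteq> C" "0 \<in> I" using I.Icarr I.zero_closed by auto
  show add: "\<And>x y. x \<in> I \<Longrightarrow> y \<in> I \<Longrightarrow> x + y \<in> I"
    using I.a_closed by auto
  show mult: "\<And>x a. x \<in> I \<Longrightarrow> a \<in> C \<Longrightarrow> a * x \<in> I"
    using I.I_l_closed by auto
  show "\<And>x y. x \<in> I \<Longrightarrow> y \<in> I \<Longrightarrow> x - y \<in> I"
    using add mult[of _ "-1"] uminus_mem[OF one_mem] by fastforce
qed

lemma genideal_3_eq: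
  assumes "a \<in> C" "b \<in> C" "c \<in> C"
  shows "genideal (ring_on C) {a, b, c} =
    {r * a + s * b + t * c | r s t. r \<in> C \<and> s \<in> C \<and> t \<in> C}" (is "_ = ?M")
proof
  have "ideal ?M (ring_on C)"
  proof (rule ideal_ring_onI)
    show "0 \<in> ?M" using zero_mem by (fastforce intro: exI[of _ 0])
  next
    fix x y assume "x \<in> ?M" "y \<in> ?M"
    then obtain r s t r' s' t' where "r \<in> C \<and> s \<in> C \<and> t \<in> C" "r' \<in> C \<and> s' \<in> C \<and> t' \<in> C"
      "x = r * a + s * b + t * c" "y = r' * a + s' * b + t' * c" by blast
    moreover from this have "x + y = (r + r') * a + (s + s') * b + (t + t') * c"
      by (simp add: algebra_simps)
    ultimately show "x + y \<in> ?M" using add_mem by blast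
  next
    fix x z assume "x \<in> ?M" "z \<in> C"
    then obtain r s t where "r \<in> C \<and> s \<in> C \<and> t \<in> C" "x = r * a + s * b + t * c" by blast
    moreover from this have "z * x = (z * r) * a + (z * s) * b + (z * t) * c"
      by (simp add: algebra_simps)
    ultimately show "z * x \<in> ?M" using mult_mem \<open>z \<in> C\<close> by blast
  qed (use assms add_mem mult_mem in auto)
  moreover have "a \<in> ?M"
    by (rule CollectI, rule exI[of _ 1], rule exI[of _ 0], rule exI[of _ 0])
      (simp add: one_mem zero_mem)
  moreover have "b \<in> ?M"
    by (rule CollectI, rule exI[of _ 0], rule exI[of _ 1], rule exI[of _ 0])
      (simp add: one_mem zero_mem)
  moreover have "c \<in> ?M"
    by (rule CollectI, rule exI[of _ 0], rule exI[of _ 0], rule exI[of _ 1])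
      (simp add: one_mem zero_mem)
  ultimately show "genideal (ring_on C) {a, b, c} \<subseteq> ?M"
    by (intro genideal_minimal) auto
next
  have sub: "{a, b, c} \<subseteq> carrier (ring_on C)" using assms by auto
  note gen = ideal_closed[OF genideal_ideal[OF sub]]
  have "a \<in> genideal (ring_on C) {a, b, c}" "b \<in> genideal (ring_on C) {a, b, c}"
    "c \<in> genideal (ring_on C) {a, b, c}"
    using genideal_self[OF sub] by auto
  then show "?M \<subseteq> genideal (ring_on C) {a, b, c}"
    by (auto intro!: gen(3,4))
qed

end

interpretation type_ring: type_subring UNIV
  by unfold_locales auto

section \<open>The dimension of a quotient by an ideal\<close>

text \<open>
  The dimension of \<open>C / I\<close> enters the proof only through linear independence modulo \<open>I\<close>: a quotient
  of dimension \<open>n\<close> has an independent family of size \<open>n\<close> and no larger one. These two facts also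
  hold when \<open>C / I\<close> is the zero ring, where the scalars do not form a subfield.
\<close>

locale quotient_over_field = type_subring C for C :: "'r::comm_ring_1 set" +
  fixes I :: "'r set" and \<kappa> :: "'k::field \<Rightarrow> 'r"
  assumes ideal: "ideal I (ring_on C)"
    and \<kappa>_mem: "\<kappa> c \<in> C"
    and \<kappa>_1: "\<kappa> 1 = 1" and \<kappa>_add: "\<kappa> (a + b) = \<kappa> a + \<kappa> b"
    and \<kappa>_mult: "\<kappa> (a * b) = \<kappa> a * \<kappa> b"
begin

definition independent_mod :: "'t set \<Rightarrow> ('t \<Rightarrow> 'r) \<Rightarrow> bool" where
  "independent_mod T b \<longleftrightarrow> finite T \<and> b ` T \<subseteq> C \<and>
     (\<forall>c. (\<Sum>t\<in>T. \<kappa> (c t) * b t) \<in> I \<longrightarrow> (\<forall>t\<in>T. c t = 0))"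

abbreviation (input) "Q \<equiv> ring_on C Quot I"
abbreviation (input) "\<pi> r \<equiv> I +>\<^bsub>ring_on C\<^esub> r"
abbreviation (input) "K \<equiv> range (\<lambda>c. \<pi> (\<kappa> c))"

interpretation I: ideal I "ring_on C" by (rule ideal)

lemma independent_mod_empty [simp]: "independent_mod {} b"
  by (simp add: independent_mod_def)

lemma \<kappa>_0: "\<kappa> 0 = 0"
  using \<kappa>_add[of 0 0] by simp

lemma \<pi>_hom: "ring_hom_ring (ring_on C) Q \<pi>"
  by (rule I.rcos_ring_hom_ring)

interpretation Q: ring Q by (rule I.quotient_is_ring)
interpretation \<pi>: ring_hom_ring "ring_on C" Q \<pi> by (rule \<pi>_hom)

lemma \<pi>_eq_0_iff: "r \<in> C \<Longrightarrow> \<pi> r = \<zero>\<^bsub>Q\<^esub> \<longleftrightarrow> r \<in> I"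
  using I.a_rcos_self[of r] I.a_rcos_const[of r] by (auto simp: FactRing_def)

lemma Q_elem: "x \<in> carrier Q \<Longrightarrow> \<exists>r\<in>C. x = \<pi> r"
  by (auto simp: FactRing_def A_RCOSETS_def')

lemma \<pi>_carrier: "r \<in> C \<Longrightarrow> \<pi> r \<in> carrier Q"
  using \<pi>.hom_closed by simp

lemma subfield_K:
  assumes "1 \<notin> I" shows "subfield K Q"
proof -
  interpret k: field "ring_of_type_algebra :: 'k ring" by (rule field_from_type_algebra)
  have "(\<lambda>c. \<pi> (\<kappa> c)) \<in> ring_hom ring_of_type_algebra Q"
    using \<pi>.hom_add \<pi>.hom_mult \<pi>.hom_one \<kappa>_mem \<pi>_carrier
    by (intro ring_hom_memI) (auto simp: \<kappa>_add \<kappa>_mult \<kappa>_1)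
  then interpret h: ring_hom_ring "ring_of_type_algebra :: 'k ring" Q "\<lambda>c. \<pi> (\<kappa> c)"
    by (intro ring_hom_ring.intro ring_hom_ring_axioms.intro k.ring_axioms Q.ring_axioms)
  have "subfield UNIV (ring_of_type_algebra :: 'k ring)"
    using k.carrier_is_subfield by simp
  moreover have "\<one>\<^bsub>Q\<^esub> \<noteq> \<zero>\<^bsub>Q\<^esub>"
    using \<pi>_eq_0_iff[OF one_mem] assms \<pi>.hom_one by simp
  ultimately show ?thesis using h.img_is_subfield(2)[of UNIV] by simp
qed

lemma sum_mem: "finite T \<Longrightarrow> b ` T \<subseteq> C \<Longrightarrow> (\<Sum>t\<in>T. \<kappa> (c t) * b t) \<in> C"
  by (induction T rule: finite_induct) (auto simp: zero_mem add_mem mult_mem \<kappa>_mem)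

text \<open>
  The lists that define independence in the quotient are traded for finite sums in \<open>C\<close>.
\<close>

lemma combine_\<pi>:
  assumes "distinct ts" "b ` set ts \<subseteq> C"
  shows "ring.combine Q (map (\<lambda>t. \<pi> (\<kappa> (c t))) ts) (map (\<lambda>t. \<pi> (b t)) ts)
    = \<pi> (\<Sum>t\<in>set ts. \<kappa> (c t) * b t)"
  using assms
proof (induction ts)
  case Nil
  then show ?case using \<pi>.hom_zero by simp
next
  case (Cons t ts)
  then show ?case
    using \<pi>.hom_add[of "\<kappa> (c t) * b t" "\<Sum>t\<in>set ts. \<kappa> (c t) * b t"] \<pi>.hom_mult[of "\<kappa> (c t)" "b t"]
      sum_mem[of "set ts" b c]
    by (simp add: \<kappa>_mem mult_mem)
qed

lemma K_list:
  assumes "distinct ts" "set Ks \<subseteq> K" "length Ks = length ts"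
  shows "\<exists>c. Ks = map (\<lambda>t. \<pi> (\<kappa> (c t))) ts"
  using assms
proof (induction ts arbitrary: Ks)
  case (Cons t ts)
  then obtain k Ks' where Ks: "Ks = \<pi> (\<kappa> k) # Ks'" "set Ks' \<subseteq> K" "length Ks' = length ts"
    by (cases Ks) auto
  then obtain c where "Ks' = map (\<lambda>t. \<pi> (\<kappa> (c t))) ts"
    using Cons.IH[OF _ Ks(2,3)] Cons.prems(1) by auto
  with Ks Cons.prems show ?case
    by (intro exI[of _ "c(t := k)"]) auto
qed auto

text \<open>
  Coefficient lists in the quotient may be shorter or longer than the list of vectors, whereas the
  sums have exactly one coefficient for each index.
\<close>

lemma independent_iff:
  assumes "1 \<notin> I" "distinct ts" "b ` set ts \<subseteq> C"
  shows "ring.independent Q K (map (\<lambda>t. \<pi> (b t)) ts) \<longleftrightarrow> independent_mod (set ts) b"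
proof -
  note sf = subfield_K[OF assms(1)]
  have \<kappa>_zero: "c = 0" if "\<pi> (\<kappa> c) = \<zero>\<^bsub>Q\<^esub>" for c
  proof (rule ccontr)
    assume "c \<noteq> 0"
    have "\<kappa> c \<in> I" using that \<pi>_eq_0_iff \<kappa>_mem by blast
    then have "\<kappa> (inverse c) * \<kappa> c \<in> I" using ideal_closed(4)[OF ideal] \<kappa>_mem by blast
    with assms(1) \<open>c \<noteq> 0\<close> show False by (simp flip: \<kappa>_mult add: \<kappa>_1)
  qed
  show ?thesis
  proof
    assume ind: "ring.independent Q K (map (\<lambda>t. \<pi> (b t)) ts)"
    have "c t = 0" if "(\<Sum>t\<in>set ts. \<kappa> (c t) * b t) \<in> I" "t \<in> set ts" for c t
    proof -
      have "ring.combine Q (map (\<lambda>t. \<pi> (\<kappa> (c t))) ts) (map (\<lambda>t. \<pi> (b t)) ts) = \<zero>\<^bsub>Q\<^esub>"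
        using that(1) unfolding combine_\<pi>[OF assms(2,3)] \<pi>_eq_0_iff[OF sum_mem[OF finite_set assms(3)]] .
      from Q.independent_imp_trivial_combine[OF sf ind _ this]
      have "(\<lambda>t. \<pi> (\<kappa> (c t))) ` set ts \<subseteq> {\<zero>\<^bsub>Q\<^esub>}" by (simp add: image_subset_iff)
      then show ?thesis using that(2) \<kappa>_zero by blast
    qed
    then show "independent_mod (set ts) b"
      using assms(3) by (auto simp: independent_mod_def)
  next
    assume ind: "independent_mod (set ts) b"
    show "ring.independent Q K (map (\<lambda>t. \<pi> (b t)) ts)"
    proof (rule Q.trivial_combine_imp_independent[OF sf])
      show "set (map (\<lambda>t. \<pi> (b t)) ts) \<subseteq> carrier Q" using assms(3) \<pi>_carrier by auto
    next
      fix Ks assume Ks: "set Ks \<subseteq> K" "ring.combine Q Ks (map (\<lambda>t. \<pi> (b t)) ts) = \<zero>\<^bsub>Q\<^esub>"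
      define m where "m = length ts"
      have z: "\<zero>\<^bsub>Q\<^esub> = \<pi> (\<kappa> 0)" using \<pi>.hom_zero \<kappa>_0 by simp
      \<comment> \<open>truncating and padding with zeros does not change the combination\<close>
      define Ls where "Ls = take m Ks @ replicate (m - length Ks) (\<zero>\<^bsub>Q\<^esub>)"
      have bs: "set (map (\<lambda>t. \<pi> (b t)) ts) \<subseteq> carrier Q" using assms(3) \<pi>_carrier by auto
      have "ring.combine Q Ls (map (\<lambda>t. \<pi> (b t)) ts) = ring.combine Q (take m Ks) (map (\<lambda>t. \<pi> (b t)) ts)"
        unfolding Ls_def by (rule Q.combine_append_replicate[OF bs])
      then have "ring.combine Q Ls (map (\<lambda>t. \<pi> (b t)) ts) = \<zero>\<^bsub>Q\<^esub>"
        using Ks(2) Q.combine_take[of "map (\<lambda>t. \<pi> (b t)) ts" Ks] by (simp add: m_def)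
      moreover have "set Ls \<subseteq> K" "length Ls = length ts"
        using Ks(1) z by (auto simp: Ls_def m_def dest: in_set_takeD)
      then obtain c where c: "Ls = map (\<lambda>t. \<pi> (\<kappa> (c t))) ts" using K_list[OF assms(2)] by blast
      ultimately have "(\<Sum>t\<in>set ts. \<kappa> (c t) * b t) \<in> I"
        using combine_\<pi>[OF assms(2,3), of c] \<pi>_eq_0_iff[OF sum_mem[OF finite_set assms(3)]] by simp
      with ind have "\<forall>t\<in>set ts. c t = 0" by (auto simp: independent_mod_def)
      then have "set Ls \<subseteq> {\<zero>\<^bsub>Q\<^esub>}" using c z by auto
      then show "set (take (length (map (\<lambda>t. \<pi> (b t)) ts)) Ks) \<subseteq> {\<zero>\<^bsub>Q\<^esub>}"
        by (auto simp: Ls_def m_def)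
    qed
  qed
qed

text \<open>
  In the zero ring the image of the scalars is not a subfield, so the uniqueness of dimension is
  checked by hand: a dimension above \<open>0\<close> would need a vector outside a set that contains zero.
\<close>

lemma zero_ring:
  assumes "1 \<in> I"
  shows "quotient_dim (ring_on C) \<kappa> I = 0" "C = I"
proof -
  show CI: "C = I"
    using ideal_closed(1)[OF ideal] ideal_closed(4)[OF ideal assms] by auto
  have carr: "carrier Q = {\<zero>\<^bsub>Q\<^esub>}"
    using Q_elem \<pi>_eq_0_iff CI Q.zero_closed by blast
  have zero_mem_dim: "\<zero>\<^bsub>Q\<^esub> \<in> E" if "ring.dimension Q m K' E" for m K' E
    using that
  proof (induction rule: Q.dimension.induct)
    case (Suc_dim v E n K)
    have "v = \<zero>\<^bsub>Q\<^esub>" using Suc_dim.hyps(1) unfolding carr by (rule singletonD)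
    with Suc_dim.hyps(2) Suc_dim.IH show ?case by metis
  qed (rule singletonI)
  have dim0: "n = 0" if "ring.dimension Q n K (carrier Q)" for n
    using that
  proof (cases rule: Q.dimension.cases)
    case (Suc_dim v E m)
    have "v = \<zero>\<^bsub>Q\<^esub>" using Suc_dim(3) unfolding carr by (rule singletonD)
    with zero_mem_dim[OF Suc_dim(5)] Suc_dim(4) show ?thesis by metis
  qed
  moreover have fin: "ring.dimension Q 0 K (carrier Q)"
    unfolding carr by (rule Q.zero_dim)
  ultimately have "ring.dim Q K (carrier Q) = 0"
    unfolding Q.dim_def by (intro the_equality) auto
  moreover have "ring.finite_dimension Q K (carrier Q)"
    using fin by (auto simp: Q.finite_dimension_def)
  ultimately show "quotient_dim (ring_on C) \<kappa> I = 0"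
    by (simp add: quotient_dim_def Let_def zero_enat_def)
qed

lemma quotient_dim_dimension:
  assumes "1 \<notin> I" "quotient_dim (ring_on C) \<kappa> I = enat n"
  shows "ring.dimension Q n K (carrier Q)"
proof -
  have "ring.finite_dimension Q K (carrier Q)" "ring.dim Q K (carrier Q) = n"
    using assms(2) by (auto simp: quotient_dim_def Let_def split: if_splits)
  then show ?thesis
    using Q.finite_dimensionE[OF subfield_K[OF assms(1)]] by (auto simp: over_def)
qed

lemma quotient_dim_eq_imp_independent:
  assumes "quotient_dim (ring_on C) \<kappa> I = enat n"
  shows "\<exists>b. independent_mod {..<n} b"
proof (cases "1 \<in> I")
  case True
  then show ?thesis using zero_ring(1) assms by (auto simp: zero_enat_def)
next
  case False
  obtain Vs where Vs: "set Vs \<subseteq> carrier Q" "ring.independent Q K Vs" "length Vs = n"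
    using Q.exists_base[OF subfield_K[OF False] quotient_dim_dimension[OF False assms]] by blast
  have "\<forall>i<n. \<exists>r\<in>C. Vs ! i = \<pi> r"
    using Vs Q_elem by (metis nth_mem subsetD)
  then obtain b where b: "\<And>i. i < n \<Longrightarrow> b i \<in> C \<and> Vs ! i = \<pi> (b i)" by metis
  then have "Vs = map (\<lambda>t. \<pi> (b t)) [0..<n]"
    using Vs(3) by (intro nth_equalityI) auto
  moreover have "b ` set [0..<n] \<subseteq> C" using b by auto
  ultimately have "independent_mod (set [0..<n]) b"
    using independent_iff[OF False distinct_upt] Vs(2) by metis
  then show ?thesis by (auto simp: atLeast0LessThan)
qed

lemma independent_card_le_quotient_dim:
  assumes "quotient_dim (ring_on C) \<kappa> I = enat n" "independent_mod T b"
  shows "card T \<le> n"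
proof (cases "1 \<in> I")
  case True
  have "finite T" "b ` T \<subseteq> C" using assms(2) by (auto simp: independent_mod_def)
  from sum_mem[OF this, of "\<lambda>_. 1"] have "(\<Sum>t\<in>T. \<kappa> 1 * b t) \<in> I"
    using zero_ring(2)[OF True] by simp
  then have "\<forall>t\<in>T. (1::'k) = 0"
    using assms(2) unfolding independent_mod_def by (elim conjE allE[of _ "\<lambda>_. 1"]) simp
  then show ?thesis by (cases "T = {}") auto
next
  case False
  obtain ts where ts: "set ts = T" "distinct ts"
    using finite_distinct_list[of T] assms(2) unfolding independent_mod_def by metis
  have C: "b ` set ts \<subseteq> C" using assms(2) ts by (auto simp: independent_mod_def)
  have "ring.independent Q K (map (\<lambda>t. \<pi> (b t)) ts)"
    using independent_iff[OF False ts(2) C] assms(2) ts by auto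
  from Q.independent_length_le_dimension[OF subfield_K[OF False] quotient_dim_dimension[OF False assms(1)] this]
  moreover have "set (map (\<lambda>t. \<pi> (b t)) ts) \<subseteq> carrier Q" using C \<pi>_carrier by auto
  ultimately have "length ts \<le> n" by (metis length_map)
  then show ?thesis using ts by (metis distinct_card)
qed

lemma finite_quotient_dim:
  assumes "finite T" "b ` T \<subseteq> C"
    and span: "\<And>r. r \<in> C \<Longrightarrow> \<exists>c. r - (\<Sum>t\<in>T. \<kappa> (c t) * b t) \<in> I"
  shows "quotient_dim (ring_on C) \<kappa> I \<noteq> \<infinity>"
proof (cases "1 \<in> I")
  case True
  then show ?thesis using zero_ring by auto
next
  case False
  note sf = subfield_K[OF False]
  obtain ts where ts: "set ts = T" "distinct ts"
    using finite_distinct_list assms(1) by auto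
  define Us where "Us = map (\<lambda>t. \<pi> (b t)) ts"
  have C: "b ` set ts \<subseteq> C" using assms(2) ts by auto
  have Us: "set Us \<subseteq> carrier Q" using C \<pi>_carrier by (auto simp: Us_def)
  have "carrier Q \<subseteq> ring.Span Q K Us"
  proof
    fix x assume "x \<in> carrier Q"
    then obtain r where r: "r \<in> C" "x = \<pi> r" using Q_elem by blast
    then obtain c where c: "r - (\<Sum>t\<in>T. \<kappa> (c t) * b t) \<in> I" using span by blast
    let ?s = "\<Sum>t\<in>T. \<kappa> (c t) * b t"
    have s: "?s \<in> C" using sum_mem assms by blast
    have "x = \<pi> (?s + (r - ?s))" using r by simp
    also have "\<dots> = \<pi> ?s \<oplus>\<^bsub>Q\<^esub> \<pi> (r - ?s)"
      using \<pi>.hom_add[of ?s "r - ?s"] s ideal_closed(1)[OF ideal] c by auto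
    also have "\<dots> = \<pi> ?s"
      using \<pi>_eq_0_iff[of "r - ?s"] c ideal_closed(1)[OF ideal] \<pi>_carrier[OF s] by auto
    also have "\<dots> = ring.combine Q (map (\<lambda>t. \<pi> (\<kappa> (c t))) ts) Us"
      using combine_\<pi>[OF ts(2) C, of c] ts by (simp add: Us_def)
    also have "\<dots> \<in> ring.Span Q K Us"
      unfolding Q.Span_eq_combine_set[OF sf Us]
      by (intro CollectI exI[of _ "map (\<lambda>t. \<pi> (\<kappa> (c t))) ts"]) auto
    finally show "x \<in> ring.Span Q K Us" .
  qed
  then have "ring.Span Q K Us = carrier Q"
    using Q.Span_in_carrier[OF subfieldE(3)[OF sf] Us] by (intro equalityI)
  then have "ring.finite_dimension Q K (carrier Q)"
    using Q.Span_finite_dimension[OF sf Us] by metis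
  then show ?thesis by (simp add: quotient_dim_def Let_def)
qed

end


section \<open>Ternary polynomials and forms\<close>

abbreviation coeff3 :: "'a::zero poly3 \<Rightarrow> nat \<Rightarrow> nat \<Rightarrow> nat \<Rightarrow> 'a" where
  "coeff3 P i j k \<equiv> coeff (coeff (coeff P k) j) i"

lemma poly3_eqI: "(\<And>i j k. coeff3 P i j k = coeff3 Q i j k) \<Longrightarrow> P = Q"
  by (intro poly_eqI)

definition is_ring_hom :: "('a::comm_ring_1 \<Rightarrow> 'b::comm_ring_1) \<Rightarrow> bool" where
  "is_ring_hom f \<longleftrightarrow> f 1 = 1 \<and> (\<forall>x y. f (x + y) = f x + f y) \<and> (\<forall>x y. f (x * y) = f x * f y)"

lemma is_ring_hom_sel:
  assumes "is_ring_hom f"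
  shows "f 1 = 1" "f (x + y) = f x + f y" "f (x * y) = f x * f y" "f 0 = 0"
    "f (- x) = - f x" "f (x - y) = f x - f y" "f (x ^ n) = f x ^ n" "f (of_nat n) = of_nat n"
proof -
  show 1: "f 1 = 1" and add: "\<And>x y. f (x + y) = f x + f y" and mult: "\<And>x y. f (x * y) = f x * f y"
    using assms by (auto simp: is_ring_hom_def)
  show 0: "f 0 = 0" using add[of 0 0] by simp
  show um: "\<And>x. f (- x) = - f x" using add[of "- x" x for x] 0
    by (simp add: eq_neg_iff_add_eq_0)
  show "f (x - y) = f x - f y" using add[of x "- y"] um by simp
  show "f (x ^ n) = f x ^ n" by (induction n) (auto simp: 1 mult)
  show "f (of_nat n) = of_nat n" by (induction n) (auto simp: 0 1 add)
qed

lemma is_ring_hom_sum: "is_ring_hom f \<Longrightarrow> f (\<Sum>t\<in>T. g t) = (\<Sum>t\<in>T. f (g t))"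
  by (induction T rule: infinite_finite_induct) (auto simp: is_ring_hom_sel)

lemma is_ring_hom_map_poly:
  assumes "is_ring_hom f" shows "is_ring_hom (map_poly f)"
  unfolding is_ring_hom_def
proof (intro conjI allI)
  note f = is_ring_hom_sel[OF assms]
  show "map_poly f 1 = 1" using f by simp
  show "map_poly f (p + q) = map_poly f p + map_poly f q" for p q
    by (intro poly_eqI) (simp add: coeff_map_poly f)
  show "map_poly f (p * q) = map_poly f p * map_poly f q" for p q
    by (intro poly_eqI) (simp add: coeff_map_poly coeff_mult is_ring_hom_sum[OF assms] f)
qed

lemma is_ring_hom_poly: "is_ring_hom (\<lambda>p. poly p a)"
  by (simp add: is_ring_hom_def)

lemma is_ring_hom_of_int: "is_ring_hom of_int"
  by (simp add: is_ring_hom_def)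

lemma pderiv_map_poly: "is_ring_hom f \<Longrightarrow> pderiv (map_poly f p) = map_poly f (pderiv p)"
  by (intro poly_eqI) (simp add: coeff_map_poly coeff_pderiv is_ring_hom_sel)

text \<open>
  Dehomogenization in the charts \<open>X \<noteq> 0\<close>, \<open>Y \<noteq> 0\<close> and \<open>Z \<noteq> 0\<close>.
\<close>

definition at_X :: "'a::comm_ring_1 poly3 \<Rightarrow> 'a poly poly" where
  "at_X = map_poly (map_poly (\<lambda>c. poly c 1))"
definition at_Y :: "'a::comm_ring_1 poly3 \<Rightarrow> 'a poly poly" where
  "at_Y = map_poly (\<lambda>c. poly c 1)"
definition at_Z :: "'a::comm_ring_1 poly3 \<Rightarrow> 'a poly poly" where
  "at_Z P = poly P 1"

lemma is_ring_hom_at: "is_ring_hom at_X" "is_ring_hom at_Y" "is_ring_hom at_Z"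
  unfolding at_X_def at_Y_def at_Z_def
  by (intro is_ring_hom_map_poly is_ring_hom_poly)+

lemma coeff_of_nat_mult: "coeff (of_nat n * p) m = of_nat n * coeff p m"
  for p :: "'b::comm_ring_1 poly"
  by (simp add: of_nat_poly)

lemma coeff3_partial:
  "coeff3 (partialX P) i j k = of_nat (Suc i) * coeff3 P (Suc i) j k"
  "coeff3 (partialY P) i j k = of_nat (Suc j) * coeff3 P i (Suc j) k"
  "coeff3 (partialZ P) i j k = of_nat (Suc k) * coeff3 P i j (Suc k)"
  by (simp_all add: partialX_def partialY_def partialZ_def coeff_map_poly coeff_pderiv
      coeff_of_nat_mult del: of_nat_Suc)

text \<open>
  Differentiation with respect to an inner variable commutes with setting an outer one to \<open>1\<close>,
  because evaluation at \<open>1\<close> only adds the coefficients.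
\<close>

lemma poly_at_1_derivation:
  fixes p :: "'b::comm_ring_1 poly" and D :: "'b \<Rightarrow> 'c::comm_ring_1"
  assumes "\<And>x y. D (x + y) = D x + D y"
  shows "D (poly p 1) = poly (map_poly D p) 1"
proof -
  have D0: "D 0 = 0" using assms[of 0 0] by simp
  show ?thesis
  proof (induction p)
    case (pCons a p)
    then show ?case by (simp add: map_poly_pCons D0 assms)
  qed (simp add: D0)
qed

lemma at_partial:
  "at_X (partialY P) = map_poly pderiv (at_X P)" "at_X (partialZ P) = pderiv (at_X P)"
  "at_Y (partialX P) = map_poly pderiv (at_Y P)" "at_Y (partialZ P) = pderiv (at_Y P)"
  "at_Z (partialX P) = map_poly pderiv (at_Z P)" "at_Z (partialY P) = pderiv (at_Z P)"
proof -
  show "at_X (partialY P) = map_poly pderiv (at_X P)"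
    unfolding at_X_def partialY_def
    by (intro poly_eqI) (simp add: coeff_map_poly pderiv_map_poly[OF is_ring_hom_poly])
  show "at_X (partialZ P) = pderiv (at_X P)"
    unfolding at_X_def partialZ_def
    by (simp add: pderiv_map_poly is_ring_hom_map_poly is_ring_hom_poly)
  have add: "map_poly pderiv (x + y) = map_poly pderiv x + map_poly pderiv y" for x y :: "'a poly poly"
    by (intro poly_eqI) (simp add: coeff_map_poly pderiv_add)
  show "at_Y (partialX P) = map_poly pderiv (at_Y P)"
    unfolding at_Y_def partialX_def
    by (intro poly_eqI) (simp add: coeff_map_poly poly_at_1_derivation[of pderiv] pderiv_add)
  show "at_Y (partialZ P) = pderiv (at_Y P)"
    unfolding at_Y_def partialZ_def
    by (simp add: pderiv_map_poly is_ring_hom_map_poly is_ring_hom_poly)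
  show "at_Z (partialX P) = map_poly pderiv (at_Z P)"
    unfolding at_Z_def partialX_def using poly_at_1_derivation[of "map_poly pderiv" P] add by simp
  show "at_Z (partialY P) = pderiv (at_Z P)"
    unfolding at_Z_def partialY_def using poly_at_1_derivation[of pderiv P] by (simp add: pderiv_add)
qed

definition mono3 :: "'a::zero \<Rightarrow> nat \<Rightarrow> nat \<Rightarrow> nat \<Rightarrow> 'a poly3" where
  "mono3 c i j k = monom (monom (monom c i) j) k"

lemma coeff3_mono3:
  "coeff3 (mono3 c i j k) i' j' k' = (if i = i' \<and> j = j' \<and> k = k' then c else 0)"
  by (simp add: mono3_def)

lemma mono3_mult: "mono3 a i j k * mono3 b i' j' k' = mono3 (a * b) (i + i') (j + j') (k + k')"
  by (simp add: mono3_def mult_monom)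

lemma var_eq_mono3: "varX = mono3 1 1 0 0" "varY = mono3 1 0 1 0" "varZ = mono3 1 0 0 1"
  by (simp_all add: mono3_def varX_def varY_def varZ_def monom_altdef one_pCons)

lemma var_power:
  "varX ^ n = (mono3 1 n 0 0 :: 'a::comm_ring_1 poly3)"
  "varY ^ n = (mono3 1 0 n 0 :: 'a poly3)" "varZ ^ n = (mono3 1 0 0 n :: 'a poly3)"
proof -
  have "mono3 1 0 0 0 = (1 :: 'a poly3)" by (simp add: mono3_def one_pCons monom_altdef)
  then show "varX ^ n = (mono3 1 n 0 0 :: 'a poly3)"
    "varY ^ n = (mono3 1 0 n 0 :: 'a poly3)" "varZ ^ n = (mono3 1 0 0 n :: 'a poly3)"
    by (induction n) (auto simp: var_eq_mono3 mono3_mult)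
qed

lemma at_mono3:
  "at_X (mono3 c i j k) = monom (monom c j) k" "at_Y (mono3 c i j k) = monom (monom c i) k"
  "at_Z (mono3 c i j k) = monom (monom c i) j"
  by (simp_all add: at_X_def at_Y_def at_Z_def mono3_def map_poly_monom poly_monom)

lemma homogeneous_coeff: "homogeneous n P \<Longrightarrow> i + j + k \<noteq> n \<Longrightarrow> coeff3 P i j k = 0"
  by (auto simp: homogeneous_def)

lemma homogeneous_0 [simp]: "homogeneous n 0" by (simp add: homogeneous_def)

lemma homogeneousI: "(\<And>i j k. i + j + k \<noteq> n \<Longrightarrow> coeff3 P i j k = 0) \<Longrightarrow> homogeneous n P"
  by (auto simp: homogeneous_def)

lemma homogeneous_add:
  fixes P :: "'a::comm_monoid_add poly3"
  shows "homogeneous n P \<Longrightarrow> homogeneous n Q \<Longrightarrow> homogeneous n (P + Q)"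
  by (rule homogeneousI) (simp add: homogeneous_coeff)

lemma homogeneous_diff:
  fixes P :: "'a::ab_group_add poly3"
  shows "homogeneous n P \<Longrightarrow> homogeneous n Q \<Longrightarrow> homogeneous n (P - Q)"
  by (rule homogeneousI) (simp add: homogeneous_coeff)

lemma homogeneous_mono3: "i + j + k = n \<Longrightarrow> homogeneous n (mono3 c i j k)"
  by (auto simp: homogeneous_def coeff3_mono3)

text \<open>
  A non-zero coefficient of the product has a non-zero summand in its convolution, and the exponents
  of its two factors add up to the degrees.
\<close>

lemma homogeneous_mult:
  fixes P Q :: "'a::comm_ring_1 poly3"
  assumes "homogeneous m P" "homogeneous n Q" shows "homogeneous (m + n) (P * Q)"
  unfolding homogeneous_def
proof (intro allI impI)
  fix i j k assume nz: "coeff3 (P * Q) i j k \<noteq> 0"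
  have "coeff3 (P * Q) i j k = (\<Sum>c\<le>k. \<Sum>b\<le>j. \<Sum>a\<le>i. coeff3 P a b c * coeff3 Q (i - a) (j - b) (k - c))"
    by (simp add: coeff_mult coeff_sum)
  with nz obtain c where c: "c \<in> {..k}"
    "(\<Sum>b\<le>j. \<Sum>a\<le>i. coeff3 P a b c * coeff3 Q (i - a) (j - b) (k - c)) \<noteq> 0"
    by (metis (no_types, lifting) sum.not_neutral_contains_not_neutral)
  then obtain b where b: "b \<in> {..j}"
    "(\<Sum>a\<le>i. coeff3 P a b c * coeff3 Q (i - a) (j - b) (k - c)) \<noteq> 0"
    by (metis (no_types, lifting) sum.not_neutral_contains_not_neutral)
  then obtain a where a: "a \<in> {..i}" "coeff3 P a b c * coeff3 Q (i - a) (j - b) (k - c) \<noteq> 0"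
    by (metis (no_types, lifting) sum.not_neutral_contains_not_neutral)
  have "coeff3 P a b c \<noteq> 0" "coeff3 Q (i - a) (j - b) (k - c) \<noteq> 0" using a(2) by auto
  then have "a + b + c = m" "(i - a) + (j - b) + (k - c) = n"
    using assms unfolding homogeneous_def by blast+
  moreover have "c \<le> k" "b \<le> j" "a \<le> i" using a b c by auto
  ultimately show "i + j + k = m + n" by linarith
qed

lemma homogeneous_partial:
  assumes "homogeneous (Suc n) P"
  shows "homogeneous n (partialX P)" "homogeneous n (partialY P)" "homogeneous n (partialZ P)"
  using assms by (auto intro!: homogeneousI simp: coeff3_partial homogeneous_coeff)

lemma coeff3_var_mult:
  "coeff3 (varX * P) i j k = (if i = 0 then 0 else coeff3 P (i - 1) j k)"
  "coeff3 (varY * P) i j k = (if j = 0 then 0 else coeff3 P i (j - 1) k)"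
  "coeff3 (varZ * P) i j k = (if k = 0 then 0 else coeff3 P i j (k - 1))"
  by (auto simp: varX_def varY_def varZ_def coeff_pCons split: nat.splits)

lemma euler_identity:
  fixes P :: "'a::field poly3"
  assumes "homogeneous n P"
  shows "varX * partialX P + varY * partialY P + varZ * partialZ P = of_nat n * P"
proof (rule poly3_eqI)
  fix i j k
  have o: "coeff3 (of_nat n * P) i j k = of_nat n * coeff3 P i j k"
    by (simp add: of_nat_poly)
  have "coeff3 (varX * partialX P) i j k = of_nat i * coeff3 P i j k"
    "coeff3 (varY * partialY P) i j k = of_nat j * coeff3 P i j k"
    "coeff3 (varZ * partialZ P) i j k = of_nat k * coeff3 P i j k"
    by (simp_all add: coeff3_var_mult coeff3_partial del: of_nat_Suc)
  then have "coeff3 (varX * partialX P + varY * partialY P + varZ * partialZ P) i j k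
    = of_nat (i + j + k) * coeff3 P i j k"
    by (simp add: algebra_simps)
  also have "\<dots> = of_nat n * coeff3 P i j k"
    using homogeneous_coeff[OF assms, of i j k] by (cases "i + j + k = n") auto
  finally show "coeff3 (varX * partialX P + varY * partialY P + varZ * partialZ P) i j k
    = coeff3 (of_nat n * P) i j k" by (simp add: o)
qed

text \<open>
  Evaluation at \<open>1\<close> adds all coefficients. For a form, at most one of them contributes to a given
  monomial of the result; this is how \<open>P\<close> is recovered from its dehomogenization.
\<close>

lemma additive_poly_1_eq_coeff:
  fixes g :: "'b::comm_ring_1 \<Rightarrow> 'c::comm_monoid_add"
  assumes "g 0 = 0" "\<And>x y. g (x + y) = g x + g y" "\<And>j. j \<noteq> m \<Longrightarrow> g (coeff p j) = 0"
  shows "g (poly p 1) = g (coeff p m)"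
proof -
  have sum: "g (\<Sum>t\<in>T. h t) = (\<Sum>t\<in>T. g (h t))" for T and h :: "nat \<Rightarrow> 'b"
    by (induction T rule: infinite_finite_induct) (auto simp: assms)
  have "poly p 1 = (\<Sum>j\<le>max m (degree p). coeff p j)"
    unfolding poly_altdef by simp (rule sum.mono_neutral_left, auto intro: coeff_eq_0)
  then have "g (poly p 1) = (\<Sum>j\<le>max m (degree p). g (coeff p j))" using sum by simp
  also have "\<dots> = (\<Sum>j\<in>{m}. g (coeff p j))"
    by (rule sum.mono_neutral_right) (auto simp: assms(3))
  finally show ?thesis by simp
qed

section \<open>Affine charts\<close>

text \<open>
  The exponent of the variable that was set to \<open>1\<close> is determined by the degree and the other two,
  so no two monomials of a form are merged.
\<close>

lemma at_eq_0_imp_eq_0: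
  assumes "homogeneous n P" and "at_X P = 0 \<or> at_Y P = 0 \<or> at_Z P = 0"
  shows "P = 0"
proof (rule poly3_eqI, rule ccontr)
  fix i j k assume nz: "coeff3 P i j k \<noteq> coeff3 0 i j k"
  then have n: "n = i + j + k" using assms(1) by (auto simp: homogeneous_def)
  have "coeff (coeff (at_X P) k) j = coeff3 P i j k"
    using additive_poly_1_eq_coeff[of "\<lambda>x. x" i "coeff (coeff P k) j"] homogeneous_coeff[OF assms(1)] n
    by (simp add: at_X_def coeff_map_poly)
  moreover have "coeff (coeff (at_Y P) k) i = coeff3 P i j k"
    using additive_poly_1_eq_coeff[of "\<lambda>x. coeff x i" j "coeff P k"] homogeneous_coeff[OF assms(1)] n
    by (simp add: at_Y_def coeff_map_poly)
  moreover have "coeff (coeff (at_Z P) j) i = coeff3 P i j k"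
    using additive_poly_1_eq_coeff[of "\<lambda>x. coeff (coeff x j) i" k P] homogeneous_coeff[OF assms(1)] n
    by (simp add: at_Z_def)
  ultimately show False using nz assms(2) by auto
qed

lemma poly_monom_induct [case_names monom add]:
  assumes "\<And>c n. P (monom c n)" "\<And>p q. P p \<Longrightarrow> P q \<Longrightarrow> P (p + q)"
  shows "P p"
proof -
  have "P 0" using assms(1)[of 0 0] by simp
  have "P (\<Sum>i\<in>A. monom (coeff p i) i)" for A
    by (induction A rule: infinite_finite_induct) (auto simp: assms \<open>P 0\<close>)
  then show ?thesis by (metis poly_as_sum_of_monoms)
qed

lemma poly2_monom_induct [case_names monom add]:
  assumes monom: "\<And>c i j. P (monom (monom c i) j)" and add: "\<And>p q. P p \<Longrightarrow> P q \<Longrightarrow> P (p + q)"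
  shows "P p"
proof (induction p rule: poly_monom_induct)
  case (monom c n)
  show ?case
    by (induction c rule: poly_monom_induct) (auto simp: assms simp flip: add_monom)
qed (rule add)

lemma eventually_homogenization_add:
  assumes "is_ring_hom h" "\<exists>m. \<forall>n\<ge>m. \<exists>P. homogeneous n P \<and> h P = p"
    "\<exists>m. \<forall>n\<ge>m. \<exists>P. homogeneous n P \<and> h P = q"
  shows "\<exists>m. \<forall>n\<ge>m. \<exists>P. homogeneous n P \<and> h P = p + q"
proof -
  from assms(2,3) obtain m m' where m: "\<And>n. n \<ge> m \<Longrightarrow> \<exists>P. homogeneous n P \<and> h P = p"
    "\<And>n. n \<ge> m' \<Longrightarrow> \<exists>P. homogeneous n P \<and> h P = q" by metis
  have "\<exists>P. homogeneous n P \<and> h P = p + q" if "n \<ge> max m m'" for n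
  proof -
    have "n \<ge> m" "n \<ge> m'" using that by auto
    obtain P where P: "homogeneous n P" "h P = p" using m(1)[OF \<open>n \<ge> m\<close>] by blast
    obtain Q where Q: "homogeneous n Q" "h Q = q" using m(2)[OF \<open>n \<ge> m'\<close>] by blast
    show ?thesis
      using homogeneous_add[OF P(1) Q(1)] is_ring_hom_sel(2)[OF assms(1), of P Q] P(2) Q(2) 
      by (intro exI[of _ "P + Q"]) simp
  qed
  then show ?thesis by (intro exI[of _ "max m m'"]) blast
qed

text \<open>
  A polynomial need not be homogenized in its least degree: any large degree will do, and taking all
  of them lets several polynomials be homogenized to a common degree.
\<close>

lemma exists_homogenization:
  fixes h :: "'a::comm_ring_1 poly3 \<Rightarrow> 'a poly poly"
  assumes "is_ring_hom h"
    and mono: "\<And>c i j n. i + j \<le> n \<Longrightarrow> \<exists>P. homogeneous n P \<and> h P = monom (monom c i) j"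
  shows "\<exists>m. \<forall>n\<ge>m. \<exists>P. homogeneous n P \<and> h P = p"
proof (induction p rule: poly2_monom_induct)
  case (monom c i j)
  show ?case by (rule exI[of _ "i + j"]) (use mono in blast)
qed (rule eventually_homogenization_add[OF assms(1)])

text \<open>
  What the three charts have in common: \<open>h\<close> sets the variable \<open>z\<close> to \<open>1\<close>, which is injective on
  the forms of a given degree, and every polynomial comes from forms of all large degrees.
\<close>

locale affine_chart =
  fixes h :: "'a::field poly3 \<Rightarrow> 'a poly poly" and z :: "'a poly3"
  assumes is_ring_hom: "is_ring_hom h"
    and homogeneous_z: "homogeneous 1 z" and z_eq_1: "h z = 1"
    and eq_0: "\<And>n P. homogeneous n P \<Longrightarrow> h P = 0 \<Longrightarrow> P = 0"
    and homogenization: "\<And>p. \<exists>m. \<forall>n\<ge>m. \<exists>P. homogeneous n P \<and> h P = p"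

interpretation chart_X: affine_chart "at_X :: 'a::field poly3 \<Rightarrow> 'a poly poly" varX
proof (rule affine_chart.intro[OF is_ring_hom_at(1)])
  fix p :: "'a poly poly"
  show "\<exists>m. \<forall>n\<ge>m. \<exists>P. homogeneous n P \<and> at_X P = p"
  proof (rule exists_homogenization[OF is_ring_hom_at(1)])
    fix c :: 'a and i j n :: nat assume "i + j \<le> n"
    then show "\<exists>P. homogeneous n P \<and> at_X P = monom (monom c i) j"
      by (intro exI[of _ "mono3 c (n - (i + j)) i j"]) (auto simp: at_mono3 intro!: homogeneous_mono3)
  qed
qed (auto simp: var_eq_mono3 at_mono3 monom_0 one_pCons intro: homogeneous_mono3 at_eq_0_imp_eq_0)

interpretation chart_Y: affine_chart "at_Y :: 'a::field poly3 \<Rightarrow> 'a poly poly" varY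
proof (rule affine_chart.intro[OF is_ring_hom_at(2)])
  fix p :: "'a poly poly"
  show "\<exists>m. \<forall>n\<ge>m. \<exists>P. homogeneous n P \<and> at_Y P = p"
  proof (rule exists_homogenization[OF is_ring_hom_at(2)])
    fix c :: 'a and i j n :: nat assume "i + j \<le> n"
    then show "\<exists>P. homogeneous n P \<and> at_Y P = monom (monom c i) j"
      by (intro exI[of _ "mono3 c i (n - (i + j)) j"]) (auto simp: at_mono3 intro!: homogeneous_mono3)
  qed
qed (auto simp: var_eq_mono3 at_mono3 monom_0 one_pCons intro: homogeneous_mono3 at_eq_0_imp_eq_0)

interpretation chart_Z: affine_chart "at_Z :: 'a::field poly3 \<Rightarrow> 'a poly poly" varZ
proof (rule affine_chart.intro[OF is_ring_hom_at(3)])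
  fix p :: "'a poly poly"
  show "\<exists>m. \<forall>n\<ge>m. \<exists>P. homogeneous n P \<and> at_Z P = p"
  proof (rule exists_homogenization[OF is_ring_hom_at(3)])
    fix c :: 'a and i j n :: nat assume "i + j \<le> n"
    then show "\<exists>P. homogeneous n P \<and> at_Z P = monom (monom c i) j"
      by (intro exI[of _ "mono3 c i j (n - (i + j))"]) (auto simp: at_mono3 intro!: homogeneous_mono3)
  qed
qed (auto simp: var_eq_mono3 at_mono3 monom_0 one_pCons intro: homogeneous_mono3 at_eq_0_imp_eq_0)

section \<open>Codimension in a vector space\<close>

text \<open>
  Quotient spaces of a type are not types, so codimension is expressed by families that are
  independent modulo a subspace.
\<close>

locale codimension = vector_space scale
  for scale :: "'a::field \<Rightarrow> 'b::ab_group_add \<Rightarrow> 'b" (infixr \<open>*s\<close> 75)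
begin

definition family_independent_mod :: "'b set \<Rightarrow> 't set \<Rightarrow> ('t \<Rightarrow> 'b) \<Rightarrow> bool" where
  "family_independent_mod K T b \<longleftrightarrow> finite T \<and> (\<forall>c. (\<Sum>t\<in>T. c t *s b t) \<in> K \<longrightarrow> (\<forall>t\<in>T. c t = 0))"

lemma family_independent_modD:
  fixes b :: "'t \<Rightarrow> 'b" and c :: "'t \<Rightarrow> 'a"
  shows "family_independent_mod K T b \<Longrightarrow> (\<Sum>t\<in>T. c t *s b t) \<in> K \<Longrightarrow> t \<in> T \<Longrightarrow> c t = 0"
  by (auto simp: family_independent_mod_def)

lemma family_independent_mod_subset:
  fixes b :: "'t \<Rightarrow> 'b"
  assumes "family_independent_mod K T b" "T' \<subseteq> T" shows "family_independent_mod K T' b"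
  unfolding family_independent_mod_def
proof (intro conjI allI impI ballI)
  have fin: "finite T" using assms by (simp add: family_independent_mod_def)
  then show "finite T'" using assms(2) finite_subset by blast
  fix c t assume "(\<Sum>t\<in>T'. c t *s b t) \<in> K" "t \<in> T'"
  moreover have "(\<Sum>t\<in>T. (if t \<in> T' then c t else 0) *s b t) = (\<Sum>t\<in>T'. c t *s b t)"
    using assms(2) fin by (intro sum.mono_neutral_cong_right) auto
  ultimately have "(if t \<in> T' then c t else 0) = 0"
    using family_independent_modD[OF assms(1), of "\<lambda>t. if t \<in> T' then c t else 0" t] assms(2) by auto
  then show "c t = 0" using \<open>t \<in> T'\<close> by simp
qed

text \<open>
  A dependency between \<open>D\<close> and the family becomes, modulo \<open>K\<close>, a dependency within the family alone.
\<close>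

lemma independent_Un_family:
  fixes b :: "'t \<Rightarrow> 'b"
  assumes K: "subspace K" and D: "D \<subseteq> K" "independent D"
    and "family_independent_mod K T b"
  shows "inj_on b T \<and> D \<inter> b ` T = {} \<and> independent (D \<union> b ` T)"
proof -
  have "finite T" using assms(4) by (simp add: family_independent_mod_def)
  then show ?thesis using assms(4)
  proof (induction T rule: finite_induct)
    case (insert t T)
    then have IH: "inj_on b T" "D \<inter> b ` T = {}" "independent (D \<union> b ` T)"
      using family_independent_mod_subset[OF insert.prems, of T] by auto
    have "b t \<notin> span (D \<union> b ` T)"
    proof
      assume "b t \<in> span (D \<union> b ` T)"
      then obtain x y where xy: "b t = x + y" "x \<in> span D" "y \<in> span (b ` T)"
        unfolding span_Un by blast
      obtain u where u: "y = (\<Sum>v\<in>b ` T. u v *s v)"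
        using xy(3) span_finite[of "b ` T"] insert.hyps(1) by auto
      have y: "y = (\<Sum>s\<in>T. u (b s) *s b s)"
        unfolding u by (simp add: sum.reindex[OF IH(1)])
      \<comment> \<open>the relation \<open>b t - \<Sum>u (b s) b s \<in> K\<close> has coefficient \<open>1\<close> at \<open>t\<close>\<close>
      define c where "c = (\<lambda>s. if s = t then 1 else - u (b s))"
      have "(\<Sum>s\<in>T. c s *s b s) = - y"
        unfolding y sum_negf[symmetric] using insert.hyps(2)
        by (intro sum.cong) (auto simp: c_def)
      then have "(\<Sum>s\<in>insert t T. c s *s b s) = x"
        using insert.hyps xy(1) by (simp add: c_def)
      moreover have "x \<in> K" using xy(2) span_minimal[OF D(1) K] by blast
      ultimately have "c t = 0" using family_independent_modD[OF insert.prems] by blast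
      then show False by (simp add: c_def)
    qed
    then have "independent (D \<union> b ` insert t T)" and new: "b t \<notin> D \<union> b ` T"
      using IH(3) independent_insertI span_base by auto
    moreover have "inj_on b (insert t T)" using IH(1) new by auto
    moreover have "D \<inter> b ` insert t T = {}" using IH(2) new by auto
    ultimately show ?case by (intro conjI)
  qed (use D in simp)
qed

text \<open>
  The dimension count that ends the proof. The hypotheses say that \<open>C\<close> spans a subspace of \<open>K\<close> whose
  codimension in \<open>S\<close> is at most that of \<open>K\<close>. One vector of \<open>K\<close> outside the span of \<open>C\<close> would give,
  together with \<open>C\<close> and the family, more independent vectors than \<open>M\<close> has elements.
\<close>

lemma codimension_squeeze:
  fixes b :: "'t \<Rightarrow> 'b"
  assumes K: "subspace K" "K \<subseteq> S" and S: "S \<subseteq> span M" "finite M"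
    and C: "C \<subseteq> K" "independent C"
    and b: "family_independent_mod K T b" "b ` T \<subseteq> S"
    and card: "card M \<le> card C + card T"
  shows "K \<subseteq> span C"
proof (rule subsetI, rule ccontr)
  fix x assume x: "x \<in> K" "x \<notin> span C"
  let ?D = "insert x C"
  have D: "?D \<subseteq> K" "independent ?D" using x C independent_insertI by auto
  note un = independent_Un_family[OF K(1) D b(1)]
  have sub: "?D \<union> b ` T \<subseteq> span M" using D(1) K(2) S(1) b(2) by blast
  have bound: "finite (?D \<union> b ` T)" "card (?D \<union> b ` T) \<le> card M"
    using independent_span_bound[OF S(2) conjunct2[OF conjunct2[OF un]] sub] by simp_all
  have "card (?D \<union> b ` T) = card ?D + card T"
    using un bound(1) card_Un_disjoint[of ?D "b ` T"] card_image[of b T] by simp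
  moreover have "x \<notin> C" using x(2) span_base by blast
  moreover have "finite C" using bound(1) by auto
  ultimately show False using bound(2) card by simp
qed

text \<open>
  \<open>C\<close> is a basis of \<open>J\<close> and \<open>D\<close> extends it to a basis of \<open>S\<close>.
\<close>

lemma basis_with_complement:
  assumes J: "subspace J" "J \<subseteq> S" and M: "M \<subseteq> S" "independent M" "finite M" "S \<subseteq> span M"
  shows "\<exists>C D. C \<subseteq> J \<and> finite C \<and> independent C \<and> D \<subseteq> S \<and>
    family_independent_mod J D (\<lambda>d. d) \<and> card M \<le> card C + card D"
proof -
  obtain C where C: "C \<subseteq> J" "independent C" "J \<subseteq> span C"
    using maximal_independent_subset by blast
  obtain B where B: "C \<subseteq> B" "B \<subseteq> S" "independent B" "S \<subseteq> span B"
    using maximal_independent_subset_extend[of C S] C J(2) by blast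
  have finB: "finite B" using independent_span_bound[OF M(3) B(3)] B(2) M(4) by blast
  define D where "D = B - C"
  have finC: "finite C" and finD: "finite D" using finB B(1) finite_subset by (auto simp: D_def)
  have "card M \<le> card B" using independent_span_bound[OF finB M(2)] M(1) B(4) by blast
  also have "card B = card C + card D"
    using finB B(1) finC by (simp add: D_def card_Diff_subset card_mono)
  finally have card: "card M \<le> card C + card D" .
  have "family_independent_mod J D (\<lambda>d. d)"
    unfolding family_independent_mod_def
  proof (intro conjI allI impI ballI)
    fix c d assume c: "(\<Sum>t\<in>D. c t *s t) \<in> J" and d: "d \<in> D"
    then obtain u where u: "(\<Sum>t\<in>D. c t *s t) = (\<Sum>t\<in>C. u t *s t)"
      using C(3) span_finite[OF finC] by auto
    define w where "w = (\<lambda>t. if t \<in> D then c t else - u t)"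
    have "(\<Sum>t\<in>B. w t *s t) = (\<Sum>t\<in>D. w t *s t) + (\<Sum>t\<in>C. w t *s t)"
      using B(1) finB by (subst add.commute, simp add: D_def sum.subset_diff)
    also have "(\<Sum>t\<in>D. w t *s t) = (\<Sum>t\<in>D. c t *s t)" by (simp add: w_def)
    also have "(\<Sum>t\<in>C. w t *s t) = - (\<Sum>t\<in>C. u t *s t)"
      unfolding sum_negf[symmetric] by (intro sum.cong) (auto simp: w_def D_def)
    finally have "(\<Sum>t\<in>B. w t *s t) = 0" using u by simp
    then have "w d = 0" using independentD[OF B(3) finB order_refl] d by (auto simp: D_def)
    then show "c d = 0" using d by (simp add: w_def)
  qed (rule finD)
  moreover have "D \<subseteq> S" using B(2) by (auto simp: D_def)
  ultimately show ?thesis using C(1,2) card finC by (intro exI[of _ C] exI[of _ D] conjI)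
qed

end

section \<open>Forms of the Jacobian ideal\<close>

definition scale3 :: "'a::comm_ring_1 \<Rightarrow> 'a poly3 \<Rightarrow> 'a poly3" where
  "scale3 c P = [:[:[:c:]:]:] * P"

lemma coeff3_scale3 [simp]: "coeff3 (scale3 c P) i j k = c * coeff3 P i j k"
  by (simp add: scale3_def)

interpretation poly3: codimension "scale3 :: 'a::field \<Rightarrow> 'a poly3 \<Rightarrow> 'a poly3"
  by unfold_locales (auto intro!: poly3_eqI simp: algebra_simps)

lemma homogeneous_scale3: "homogeneous n P \<Longrightarrow> homogeneous n (scale3 c P)"
  by (rule homogeneousI) (simp add: homogeneous_coeff)

lemma subspace_homogeneous: "poly3.subspace {P. homogeneous n P}"
  by (auto intro!: poly3.subspaceI homogeneous_add homogeneous_scale3)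

text \<open>
  The monomials of degree \<open>n\<close> are indexed by a set that does not depend on the field. This makes the
  dimension of the space of forms the same over the rationals and over the prime field.
\<close>

definition exponents :: "nat \<Rightarrow> (nat \<times> nat \<times> nat) set" where
  "exponents n = {(i, j, k). i + j + k = n}"

definition monomials :: "nat \<Rightarrow> 'a::comm_ring_1 poly3 set" where
  "monomials n = (\<lambda>(i, j, k). mono3 1 i j k) ` exponents n"

lemma finite_exponents: "finite (exponents n)"
  by (rule finite_subset[of _ "{..n} \<times> {..n} \<times> {..n}"]) (auto simp: exponents_def)

lemma mono3_inject:
  assumes "mono3 (1::'a::comm_ring_1) i j k = mono3 1 i' j' k'"
  shows "(i, j, k) = (i', j', k')"
proof -
  have "coeff3 (mono3 (1::'a) i' j' k') i j k = 1"
    unfolding assms[symmetric] by (simp add: coeff3_mono3)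
  then show ?thesis by (simp add: coeff3_mono3 split: if_splits)
qed

lemma inj_mono3: "inj_on (\<lambda>(i, j, k). mono3 (1::'a::comm_ring_1) i j k) A"
  by (rule inj_onI) (auto dest: mono3_inject)

lemma card_monomials: "card (monomials n) = card (exponents n)"
  unfolding monomials_def by (rule card_image[OF inj_mono3])

lemma finite_monomials: "finite (monomials n)"
  by (simp add: monomials_def finite_exponents)

lemma monomials_homogeneous: "monomials n \<subseteq> {P. homogeneous n P}"
  by (auto simp: monomials_def exponents_def intro!: homogeneous_mono3)

lemma homogeneous_eq_sum:
  assumes "homogeneous n P"
  shows "P = (\<Sum>(i, j, k)\<in>exponents n. scale3 (coeff3 P i j k) (mono3 1 i j k))"
proof (rule poly3_eqI)
  fix i j k
  have "coeff3 (\<Sum>(a, b, c)\<in>exponents n. scale3 (coeff3 P a b c) (mono3 1 a b c)) i j k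
    = (\<Sum>(a, b, c)\<in>exponents n. coeff3 P a b c * coeff3 (mono3 1 a b c) i j k)"
    by (simp add: coeff_sum case_prod_unfold)
  also have "\<dots> = (\<Sum>x\<in>exponents n. if x = (i, j, k) then coeff3 P i j k else 0)"
    by (intro sum.cong) (auto simp: coeff3_mono3 split: if_splits)
  also have "\<dots> = coeff3 P i j k"
    using homogeneous_coeff[OF assms, of i j k] finite_exponents by (simp add: exponents_def)
  finally show "coeff3 P i j k =
    coeff3 (\<Sum>(i, j, k)\<in>exponents n. scale3 (coeff3 P i j k) (mono3 1 i j k)) i j k" by simp
qed

lemma homogeneous_in_span: "{P. homogeneous n P} \<subseteq> poly3.span (monomials n)"
proof clarify
  fix P :: "'a poly3" assume "homogeneous n P"
  then show "P \<in> poly3.span (monomials n)"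
    by (subst homogeneous_eq_sum, assumption, intro poly3.span_sum)
      (auto intro!: poly3.span_scale[OF poly3.span_base] intro: rev_image_eqI simp: monomials_def)
qed

lemma independent_monomials: "poly3.independent (monomials n :: 'a::field poly3 set)"
proof (rule poly3.independent_if_scalars_zero[OF finite_monomials])
  fix f :: "'a poly3 \<Rightarrow> 'a" and x :: "'a poly3"
  assume 0: "(\<Sum>x\<in>monomials n. scale3 (f x) x) = 0" and "x \<in> monomials n"
  then obtain i j k where x: "x = mono3 1 i j k" "(i, j, k) \<in> exponents n"
    by (auto simp: monomials_def)
  have "0 = (\<Sum>y\<in>exponents n. case y of (a, b, c) \<Rightarrow> scale3 (f (mono3 1 a b c)) (mono3 1 a b c))"
    using 0 unfolding monomials_def
    by (subst (asm) sum.reindex[OF inj_mono3]) (simp add: case_prod_unfold o_def)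
  then have "0 = coeff3 (\<Sum>y\<in>exponents n. case y of (a, b, c) \<Rightarrow> scale3 (f (mono3 1 a b c)) (mono3 1 a b c)) i j k"
    by simp
  also have "\<dots> = (\<Sum>y\<in>exponents n. case y of (a, b, c) \<Rightarrow> f (mono3 1 a b c) * coeff3 (mono3 1 a b c) i j k)"
    by (simp add: coeff_sum case_prod_unfold)
  also have "\<dots> = (\<Sum>y\<in>exponents n. if y = (i, j, k) then f x else 0)"
    by (intro sum.cong) (auto simp: coeff3_mono3 x split: if_splits)
  also have "\<dots> = f x" using x(2) finite_exponents by simp
  finally show "f x = 0" by simp
qed

text \<open>
  The cofactors are required to be homogeneous, which makes it possible to lift elements from one
  field to another without decomposing polynomials into homogeneous parts. A partial derivative of
  \<open>F\<close> has degree \<open>d - 1\<close>, so its cofactor has degree one more than that of \<open>F\<close>. The set is empty for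
  \<open>n < d\<close>; only large \<open>n\<close> matter. \<open>F\<close> itself is among the generators because, in characteristic
  dividing \<open>d\<close>, it need not lie in the ideal of its partial derivatives.
\<close>

definition jacobian_forms :: "nat \<Rightarrow> 'a::field poly3 \<Rightarrow> nat \<Rightarrow> 'a poly3 set" where
  "jacobian_forms d F n = {A * F + B * partialX F + C * partialY F + E * partialZ F | A B C E e.
     n = d + e \<and> homogeneous e A \<and> homogeneous (Suc e) B \<and> homogeneous (Suc e) C \<and> homogeneous (Suc e) E}"

lemma jacobian_formsI:
  "n = d + e \<Longrightarrow> homogeneous e A \<Longrightarrow> homogeneous (Suc e) B \<Longrightarrow> homogeneous (Suc e) C \<Longrightarrow>
    homogeneous (Suc e) E \<Longrightarrow> A * F + B * partialX F + C * partialY F + E * partialZ F \<in> jacobian_forms d F n"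
  by (auto simp: jacobian_forms_def)

lemma jacobian_forms_homogeneous:
  assumes "homogeneous d F" "d > 0"
  shows "jacobian_forms d F n \<subseteq> {P. homogeneous n P}"
proof clarify
  fix P assume "P \<in> jacobian_forms d F n"
  then obtain A B C E e where P: "P = A * F + B * partialX F + C * partialY F + E * partialZ F"
    and h: "n = d + e" "homogeneous e A" "homogeneous (Suc e) B" "homogeneous (Suc e) C" "homogeneous (Suc e) E"
    unfolding jacobian_forms_def by blast
  obtain d' where d: "d = Suc d'" using assms(2) by (cases d) auto
  note p = homogeneous_partial[OF assms(1)[unfolded d]]
  have "n = e + d" "n = Suc e + d'" using h(1) d by auto
  then show "homogeneous n P"
    using P homogeneous_mult[OF h(2) assms(1)] homogeneous_mult[OF h(3) p(1)]
      homogeneous_mult[OF h(4) p(2)] homogeneous_mult[OF h(5) p(3)]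
    by (auto intro!: homogeneous_add)
qed

lemma jacobian_forms_mult:
  assumes "P \<in> jacobian_forms d F n" "homogeneous m H"
  shows "H * P \<in> jacobian_forms d F (m + n)"
proof -
  obtain A B C E e where P: "P = A * F + B * partialX F + C * partialY F + E * partialZ F"
    and h: "n = d + e" "homogeneous e A" "homogeneous (Suc e) B" "homogeneous (Suc e) C" "homogeneous (Suc e) E"
    using assms(1) unfolding jacobian_forms_def by blast
  have "H * P = (H * A) * F + (H * B) * partialX F + (H * C) * partialY F + (H * E) * partialZ F"
    by (simp add: P algebra_simps)
  moreover have "m + n = d + (m + e)" "homogeneous (m + e) (H * A)" "homogeneous (Suc (m + e)) (H * B)"
    "homogeneous (Suc (m + e)) (H * C)" "homogeneous (Suc (m + e)) (H * E)"
    using h homogeneous_mult[OF assms(2)] by (auto simp flip: add_Suc_right)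
  ultimately show ?thesis using jacobian_formsI by metis
qed

lemma subspace_jacobian_forms:
  fixes F :: "'a::field poly3"
  assumes "d \<le> n" shows "poly3.subspace (jacobian_forms d F n)"
proof (rule poly3.subspaceI)
  show "0 \<in> jacobian_forms d F n"
    using jacobian_formsI[of n d "n - d" 0 0 0 0 F] assms by simp
next
  fix P Q assume "P \<in> jacobian_forms d F n" "Q \<in> jacobian_forms d F n"
  then obtain A B C E e A' B' C' E' e' where
    P: "P = A * F + B * partialX F + C * partialY F + E * partialZ F"
    and h: "n = d + e" "homogeneous e A" "homogeneous (Suc e) B" "homogeneous (Suc e) C" "homogeneous (Suc e) E"
    and Q: "Q = A' * F + B' * partialX F + C' * partialY F + E' * partialZ F"
    and h': "n = d + e'" "homogeneous e' A'" "homogeneous (Suc e') B'" "homogeneous (Suc e') C'" "homogeneous (Suc e') E'"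
    unfolding jacobian_forms_def by blast
  have "e' = e" using h(1) h'(1) by simp
  have "P + Q = (A + A') * F + (B + B') * partialX F + (C + C') * partialY F + (E + E') * partialZ F"
    by (simp add: P Q algebra_simps)
  also have "\<dots> \<in> jacobian_forms d F n"
    using h h' \<open>e' = e\<close> by (intro jacobian_formsI homogeneous_add) auto
  finally show "P + Q \<in> jacobian_forms d F n" .
next
  fix c :: 'a and P assume "P \<in> jacobian_forms d F n"
  moreover have "homogeneous 0 [:[:[:c:]:]:]"
    using homogeneous_mono3[of 0 0 0 0 c] by (simp add: mono3_def monom_0)
  ultimately show "scale3 c P \<in> jacobian_forms d F n"
    using jacobian_forms_mult[of P d F n 0 "[:[:[:c:]:]:]"] by (simp add: scale3_def)
qed


section \<open>Reduction modulo a prime and semicontinuity of rank\<close>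

lemma is_ring_hom_map_coeffs: "is_ring_hom f \<Longrightarrow> is_ring_hom (map_coeffs f)"
  unfolding map_coeffs_def[abs_def] by (intro is_ring_hom_map_poly)

lemma coeff3_map_coeffs: "f 0 = 0 \<Longrightarrow> coeff3 (map_coeffs f P) i j k = f (coeff3 P i j k)"
  by (simp add: map_coeffs_def coeff_map_poly)

lemma partial_map_coeffs:
  fixes G :: "int poly3"
  defines "\<rho> \<equiv> map_coeffs of_int :: int poly3 \<Rightarrow> 'a::field poly3"
  shows "partialX (\<rho> G) = \<rho> (map_poly (map_poly pderiv) G)"
    and "partialY (\<rho> G) = \<rho> (map_poly pderiv G)" and "partialZ (\<rho> G) = \<rho> (pderiv G)"
  by (intro poly3_eqI; simp add: \<rho>_def coeff3_map_coeffs coeff3_partial coeff_map_poly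
      coeff_pderiv coeff_of_nat_mult del: of_nat_Suc)+

lemma homogeneous_map_coeffs: "f 0 = 0 \<Longrightarrow> homogeneous n P \<Longrightarrow> homogeneous n (map_coeffs f P)"
  by (rule homogeneousI) (simp add: coeff3_map_coeffs homogeneous_coeff)

text \<open>
  The characteristic divides the number of elements, which is prime. So the integers from \<open>0\<close> to
  \<open>q - 1\<close> have distinct images, and these are all the elements.
\<close>

lemma prime_field_of_int:
  assumes "prime q" "card (UNIV :: 'k::field set) = q"
  shows "of_int z = (0::'k) \<longleftrightarrow> int q dvd z" and "surj (of_int :: int \<Rightarrow> 'k)"
proof -
  have char: "CHAR('k) = q"
  proof -
    have "CHAR('k) dvd q" using CHAR_dvd_CARD[where 'a = 'k] assms(2) by simp
    then show ?thesis using assms(1) CHAR_not_1'[where 'a = 'k] by (auto simp: prime_nat_iff)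
  qed
  show iff: "of_int z = (0::'k) \<longleftrightarrow> int q dvd z" for z
    using of_int_eq_0_iff_char_dvd[of z, where 'a = 'k] char by simp
  have "inj_on (of_int :: int \<Rightarrow> 'k) {0..<int q}"
  proof (rule inj_onI)
    fix x y assume xy: "x \<in> {0..<int q}" "y \<in> {0..<int q}" "of_int x = (of_int y :: 'k)"
    then have "int q dvd x - y" using iff[of "x - y"] by simp
    moreover have "\<bar>x - y\<bar> < int q" using xy by auto
    ultimately show "x = y" by (meson dvd_imp_le_int eq_iff_diff_eq_0 linorder_not_less abs_of_nat zdvd_not_zless zero_less_abs_iff dvd_abs_iff)
  qed
  then have "card (of_int ` {0..<int q} :: 'k set) = card (UNIV :: 'k set)"
    using assms(2) by (simp add: card_image)
  moreover have "finite (UNIV :: 'k set)"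
    using assms by (metis card.infinite not_prime_0)
  ultimately have "of_int ` {0..<int q} = (UNIV :: 'k set)" by (intro card_subset_eq) auto
  then show "surj (of_int :: int \<Rightarrow> 'k)" by auto
qed

text \<open>
  Each coefficient is lifted separately; lifting \<open>0\<close> to \<open>0\<close> preserves homogeneity.
\<close>

lemma integral_lift:
  assumes "surj (of_int :: int \<Rightarrow> 'k::field)" and "homogeneous n (P :: 'k poly3)"
  shows "\<exists>Q :: int poly3. homogeneous n Q \<and> map_coeffs of_int Q = P"
proof -
  define l :: "'k \<Rightarrow> int" where "l c = (if c = 0 then 0 else inv_into UNIV of_int c)" for c
  have l0: "l 0 = 0" by (simp add: l_def)
  have l: "of_int (l c) = c" for c
    using surj_f_inv_f[OF assms(1)] by (simp add: l_def)
  show ?thesis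
    by (intro exI[of _ "map_coeffs l P"] conjI homogeneous_map_coeffs l0 assms(2) poly3_eqI)
      (simp add: coeff3_map_coeffs l0 l)
qed

text \<open>
  The cofactors are lifted, and the lifted combination is an element of the Jacobian ideal over
  every field.
\<close>

lemma jacobian_forms_integral_lift:
  fixes G :: "int poly3"
  assumes "surj (of_int :: int \<Rightarrow> 'k::field)"
    and P: "P \<in> jacobian_forms d (map_coeffs of_int G :: 'k poly3) n"
  shows "\<exists>Q :: int poly3. map_coeffs of_int Q = P \<and>
    map_coeffs of_int Q \<in> jacobian_forms d (map_coeffs of_int G :: 'a::field poly3) n"
proof -
  have k: "is_ring_hom (map_coeffs of_int :: int poly3 \<Rightarrow> 'k poly3)"
    and a: "is_ring_hom (map_coeffs of_int :: int poly3 \<Rightarrow> 'a poly3)"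
    by (intro is_ring_hom_map_coeffs is_ring_hom_of_int)+
  note k = is_ring_hom_sel[OF k] and a = is_ring_hom_sel[OF a]
  obtain A B C E e where n: "n = d + e" and h: "homogeneous e A" "homogeneous (Suc e) B"
    "homogeneous (Suc e) C" "homogeneous (Suc e) E" and
    eq: "P = A * map_coeffs of_int G + B * partialX (map_coeffs of_int G)
      + C * partialY (map_coeffs of_int G) + E * partialZ (map_coeffs of_int G)"
    using P unfolding jacobian_forms_def by blast
  obtain A' B' C' E' :: "int poly3" where h': "homogeneous e A'" "homogeneous (Suc e) B'"
    "homogeneous (Suc e) C'" "homogeneous (Suc e) E'"
    and l: "map_coeffs of_int A' = A" "map_coeffs of_int B' = B" "map_coeffs of_int C' = C" "map_coeffs of_int E' = E"
    using h[THEN integral_lift[OF assms(1)]] by metis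
  let ?Q = "A' * G + B' * map_poly (map_poly pderiv) G + C' * map_poly pderiv G + E' * pderiv G"
  have "map_coeffs of_int ?Q = P"
    unfolding eq partial_map_coeffs k(2,3) l ..
  moreover have "map_coeffs of_int ?Q \<in> jacobian_forms d (map_coeffs of_int G :: 'a poly3) n"
    unfolding a(2,3) partial_map_coeffs[symmetric]
    by (rule jacobian_formsI[OF n]) (use h' in \<open>auto intro!: homogeneous_map_coeffs\<close>)
  ultimately show ?thesis by blast
qed

lemma common_denominator:
  fixes r :: "'t \<Rightarrow> rat"
  assumes "finite T"
  shows "\<exists>D z. D \<noteq> (0::int) \<and> (\<forall>t\<in>T. r t * of_int D = of_int (z t))"
  using assms
proof (induction T rule: finite_induct)
  case empty
  show ?case by (rule exI[of _ 1]) simp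
next
  case (insert t T)
  then obtain D z where D: "D \<noteq> 0" "\<And>t. t \<in> T \<Longrightarrow> r t * of_int D = of_int (z t)" by metis
  obtain a b where ab: "quotient_of (r t) = (a, b)" by (cases "quotient_of (r t)")
  have r: "r t = of_int a / of_int b" "b > 0"
    using quotient_of_div[OF ab] quotient_of_denom_pos[OF ab] by auto
  define w where "w = (\<lambda>s. if s = t then a * D else z s * b)"
  have "r s * of_int (D * b) = of_int (w s)" if "s \<in> insert t T" for s
  proof (cases "s = t")
    case True
    then show ?thesis using r by (simp add: w_def)
  next
    case False
    then have "r s * of_int D = of_int (z s)" using D(2) that by simp
    then have "r s * of_int D * of_int b = of_int (z s) * of_int b" by simp
    then show ?thesis using False by (simp add: w_def mult.assoc)
  qed
  moreover have "D * b \<noteq> 0" using D(1) r(2) by simp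
  ultimately show ?case by blast
qed

text \<open>
  After clearing denominators, a rational relation between the \<open>g t\<close> becomes an integral one. Its
  reduction is a relation between independent forms, so all coefficients are divisible by \<open>q\<close>.
  Dividing by \<open>q\<close> gives another integral relation. So the coefficients are divisible by every power
  of \<open>q\<close>, and they vanish.
\<close>

lemma independent_lift:
  fixes g :: "'t \<Rightarrow> int poly3"
  assumes q: "prime q" "\<And>z. of_int z = (0::'k::field) \<longleftrightarrow> int q dvd z" and fin: "finite T"
    and ind: "poly3.family_independent_mod {0} T (\<lambda>t. map_coeffs of_int (g t) :: 'k poly3)"
  shows "poly3.family_independent_mod {0} T (\<lambda>t. map_coeffs of_int (g t) :: rat poly3)"
proof -
  have red: "coeff3 (\<Sum>t\<in>T. scale3 (of_int (z t)) (map_coeffs of_int (g t) :: 'a::field poly3)) i j k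
    = of_int (\<Sum>t\<in>T. z t * coeff3 (g t) i j k)" for z i j k
    by (simp add: coeff_sum coeff3_map_coeffs)
  have dvd: "\<forall>t\<in>T. int q ^ n dvd z t" if "\<And>i j k. (\<Sum>t\<in>T. z t * coeff3 (g t) i j k) = 0" for n z
    using that
  proof (induction n arbitrary: z)
    case (Suc n)
    have "(\<Sum>t\<in>T. scale3 (of_int (z t)) (map_coeffs of_int (g t) :: 'k poly3)) = 0"
      by (rule poly3_eqI) (simp only: red Suc.prems, simp)
    then have "\<forall>t\<in>T. of_int (z t) = (0::'k)"
      using poly3.family_independent_modD[OF ind, of "\<lambda>t. of_int (z t)"] by simp
    then have "\<forall>t\<in>T. int q dvd z t" using q(2) by simp
    then obtain w where w: "\<And>t. t \<in> T \<Longrightarrow> z t = int q * w t" unfolding dvd_def by metis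
    have "int q * (\<Sum>t\<in>T. w t * coeff3 (g t) i j k) = 0" for i j k
      unfolding Suc.prems[of k j i, symmetric] sum_distrib_left
      by (intro sum.cong) (auto simp: w)
    then have "\<forall>t\<in>T. int q ^ n dvd w t" using q(1) by (intro Suc.IH) (auto simp: prime_gt_0_nat)
    then show ?case using w by auto
  qed simp
  show ?thesis
    unfolding poly3.family_independent_mod_def
  proof (intro conjI allI impI ballI)
    fix r t assume 0: "(\<Sum>t\<in>T. scale3 (r t) (map_coeffs of_int (g t) :: rat poly3)) \<in> {0}" and t: "t \<in> T"
    obtain D z where D: "D \<noteq> (0::int)" "\<And>t. t \<in> T \<Longrightarrow> r t * of_int D = of_int (z t)"
      using common_denominator[OF fin] by metis
    have "(\<Sum>t\<in>T. z t * coeff3 (g t) i j k) = 0" for i j k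
    proof -
      have "(0::rat) = of_int D * coeff3 (\<Sum>t\<in>T. scale3 (r t) (map_coeffs of_int (g t))) i j k"
        using 0 by simp
      also have "\<dots> = (\<Sum>t\<in>T. (r t * of_int D) * of_int (coeff3 (g t) i j k))"
        by (simp add: coeff_sum coeff3_map_coeffs sum_distrib_left mult_ac)
      also have "\<dots> = of_int (\<Sum>t\<in>T. z t * coeff3 (g t) i j k)"
        by (simp add: D(2))
      finally show ?thesis by (metis of_int_eq_0_iff)
    qed
    then have dv: "int q ^ n dvd z t" for n using dvd t by blast
    have "z t = 0"
    proof (rule ccontr)
      assume "z t \<noteq> 0"
      have "nat \<bar>z t\<bar> < q ^ nat \<bar>z t\<bar>"
        using less_exp power_mono[OF prime_ge_2_nat[OF q(1)]] by (rule less_le_trans) simp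
      then have "int (nat \<bar>z t\<bar>) < int (q ^ nat \<bar>z t\<bar>)" by (simp only: of_nat_less_iff)
      then have "\<bar>z t\<bar> < int q ^ nat \<bar>z t\<bar>" by simp
      moreover have "int q ^ nat \<bar>z t\<bar> \<le> \<bar>z t\<bar>"
        using dv[of "nat \<bar>z t\<bar>"] \<open>z t \<noteq> 0\<close> by (intro zdvd_imp_le) auto
      ultimately show False by simp
    qed
    then show "r t = 0" using D t by force
  qed (rule fin)
qed

lemma independent_jacobian_forms_lift:
  fixes G :: "int poly3"
  assumes "prime q" "card (UNIV :: 'k::field set) = q"
    and C: "C \<subseteq> jacobian_forms d (map_coeffs of_int G :: 'k poly3) n" "finite C" "poly3.independent C"
  shows "\<exists>C'. C' \<subseteq> jacobian_forms d (map_coeffs of_int G :: rat poly3) n \<and>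
    poly3.independent C' \<and> card C' = card C"
proof -
  note k = prime_field_of_int[OF assms(1,2)]
  obtain g :: "'k poly3 \<Rightarrow> int poly3" where g: "\<And>P. P \<in> C \<Longrightarrow> map_coeffs of_int (g P) = P"
    "\<And>P. P \<in> C \<Longrightarrow> map_coeffs of_int (g P) \<in> jacobian_forms d (map_coeffs of_int G :: rat poly3) n"
    using jacobian_forms_integral_lift[OF k(2), of _ d G n, where 'a = rat] C(1) by (metis subsetD)
  have "poly3.family_independent_mod {0} C (\<lambda>P. map_coeffs of_int (g P) :: 'k poly3)"
    unfolding poly3.family_independent_mod_def
    using C(2) poly3.independentD[OF C(3,2) order_refl] by (auto simp: g(1) cong: sum.cong)
  then have "poly3.family_independent_mod {0} C (\<lambda>P. map_coeffs of_int (g P) :: rat poly3)"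
    using independent_lift[OF assms(1) k(1) C(2)] by blast
  from poly3.independent_Un_family[OF poly3.subspace_single_0 _ _ this, of "{}"]
  have "inj_on (\<lambda>P. map_coeffs of_int (g P) :: rat poly3) C"
    "poly3.independent ((\<lambda>P. map_coeffs of_int (g P) :: rat poly3) ` C)" by (auto simp: poly3.independent_empty)
  then show ?thesis
    using g(2) by (intro exI[of _ "(\<lambda>P. map_coeffs of_int (g P) :: rat poly3) ` C"]) (auto simp: card_image)
qed


section \<open>The local Tjurina algebra at the origin\<close>

abbreviation const2 :: "'a::comm_ring_1 \<Rightarrow> 'a poly poly" where "const2 c \<equiv> [:[:c:]:]"

definition value_at_origin :: "'a::comm_ring_1 poly poly \<Rightarrow> 'a" where
  "value_at_origin g = poly (poly g 0) 0"

lemma value_at_origin_hom: "is_ring_hom value_at_origin"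
  by (simp add: is_ring_hom_def value_at_origin_def)

lemmas value_at_origin_simps [simp] = is_ring_hom_sel[OF value_at_origin_hom]

abbreviation coord_x :: "'a::comm_ring_1 poly poly" where "coord_x \<equiv> [:[:0, 1:]:]"
abbreviation coord_y :: "'a::comm_ring_1 poly poly" where "coord_y \<equiv> [:0, 1:]"

lemma value_at_origin_coord [simp]:
  "value_at_origin coord_x = 0" "value_at_origin coord_y = 0" "value_at_origin (const2 c) = c"
  by (simp_all add: value_at_origin_def)

definition tjurina_ideal :: "'a::field poly poly \<Rightarrow> 'a poly poly set" where
  "tjurina_ideal f = {a * f + b * map_poly pderiv f + c * pderiv f | a b c. True}"

text \<open>
  The polynomials whose image in the local ring at the origin lies in the ideal that \<open>tjurina_ideal\<close>
  generates there.
\<close>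

definition local_tjurina_ideal :: "'a::field poly poly \<Rightarrow> 'a poly poly set" where
  "local_tjurina_ideal f = {g. \<exists>u. value_at_origin u \<noteq> 0 \<and> u * g \<in> tjurina_ideal f}"

lemma tjurina_ideal_add: "g \<in> tjurina_ideal f \<Longrightarrow> h \<in> tjurina_ideal f \<Longrightarrow> g + h \<in> tjurina_ideal f"
proof -
  assume "g \<in> tjurina_ideal f" "h \<in> tjurina_ideal f"
  then obtain a b c a' b' c' where "g = a * f + b * map_poly pderiv f + c * pderiv f"
    "h = a' * f + b' * map_poly pderiv f + c' * pderiv f" by (auto simp: tjurina_ideal_def)
  then have "g + h = (a + a') * f + (b + b') * map_poly pderiv f + (c + c') * pderiv f"
    by (simp add: algebra_simps)
  then show ?thesis by (auto simp: tjurina_ideal_def)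
qed

lemma tjurina_ideal_mult: "g \<in> tjurina_ideal f \<Longrightarrow> h * g \<in> tjurina_ideal f"
proof -
  assume "g \<in> tjurina_ideal f"
  then obtain a b c where "g = a * f + b * map_poly pderiv f + c * pderiv f"
    by (auto simp: tjurina_ideal_def)
  then have "h * g = (h * a) * f + (h * b) * map_poly pderiv f + (h * c) * pderiv f"
    by (simp add: algebra_simps)
  then show ?thesis by (auto simp: tjurina_ideal_def)
qed

lemma tjurina_ideal_generators:
  "f \<in> tjurina_ideal f" "map_poly pderiv f \<in> tjurina_ideal f" "pderiv f \<in> tjurina_ideal f"
proof -
  have "f = 1 * f + 0 * map_poly pderiv f + 0 * pderiv f"
    "map_poly pderiv f = 0 * f + 1 * map_poly pderiv f + 0 * pderiv f"
    "pderiv f = 0 * f + 0 * map_poly pderiv f + 1 * pderiv f" by simp_all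
  then show "f \<in> tjurina_ideal f" "map_poly pderiv f \<in> tjurina_ideal f" "pderiv f \<in> tjurina_ideal f"
    unfolding tjurina_ideal_def by blast+
qed

lemma local_tjurina_ideal_superset: "g \<in> tjurina_ideal f \<Longrightarrow> g \<in> local_tjurina_ideal f"
  unfolding local_tjurina_ideal_def by (auto intro!: exI[of _ 1])

lemma origin_decomposition:
  fixes p :: "'a::comm_ring_1 poly poly"
  shows "\<exists>a b. p = const2 (value_at_origin p) + coord_x * a + coord_y * b"
proof -
  obtain p0 b where p: "p = pCons p0 b" by (cases p)
  obtain c a where p0: "p0 = pCons c a" by (cases p0)
  have "p = const2 (value_at_origin p) + coord_x * [:a:] + coord_y * b"
    by (simp add: p p0 value_at_origin_def)
  then show ?thesis by blast
qed

text \<open>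
  In each term of the binomial expansion, one of the two exponents is at least \<open>n\<close>.
\<close>

lemma power_sum_in_power_ideal:
  fixes x y :: "'r::comm_ring_1"
  shows "\<exists>s t. (x + y) ^ (2 * n) = s * x ^ n + t * y ^ n"
proof -
  have "\<exists>s t. of_nat (2 * n choose k) * x ^ k * y ^ (2 * n - k) = s * x ^ n + t * y ^ n" if "k \<le> 2 * n" for k
  proof (cases "n \<le> k")
    case True
    then have "x ^ k = x ^ (k - n) * x ^ n" by (simp flip: power_add)
    then have "of_nat (2 * n choose k) * x ^ k * y ^ (2 * n - k) =
      (of_nat (2 * n choose k) * x ^ (k - n) * y ^ (2 * n - k)) * x ^ n + 0 * y ^ n"
      by (simp add: mult_ac)
    then show ?thesis by blast
  next
    case False
    then have "2 * n - k = (n - k) + n" by simp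
    then have "y ^ (2 * n - k) = y ^ (n - k) * y ^ n" by (metis power_add)
    then have "of_nat (2 * n choose k) * x ^ k * y ^ (2 * n - k) =
      0 * x ^ n + (of_nat (2 * n choose k) * x ^ k * y ^ (n - k)) * y ^ n"
      by (simp add: mult_ac)
    then show ?thesis by blast
  qed
  then obtain s t where st: "\<And>k. k \<le> 2 * n \<Longrightarrow>
    of_nat (2 * n choose k) * x ^ k * y ^ (2 * n - k) = s k * x ^ n + t k * y ^ n" by metis
  have "(x + y) ^ (2 * n) = (\<Sum>k\<le>2 * n. s k * x ^ n + t k * y ^ n)"
    unfolding binomial_ring by (intro sum.cong) (auto simp: st)
  also have "\<dots> = (\<Sum>k\<le>2 * n. s k) * x ^ n + (\<Sum>k\<le>2 * n. t k) * y ^ n"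
    by (simp add: sum.distrib sum_distrib_right)
  finally show ?thesis by blast
qed

text \<open>
  Write \<open>m = x a + y b\<close>. Then \<open>u = c + m\<close> divides \<open>c^(2n) - (-m)^(2n)\<close>, and \<open>m^(2n)\<close> lies in the ideal
  of \<open>x^n\<close> and \<open>y^n\<close>. Inverting the unit \<open>c^(2n)\<close> gives an inverse of \<open>u\<close> modulo that ideal.
\<close>

lemma unit_mod_powers:
  fixes x y :: "'r::comm_ring_1"
  assumes u: "u = c + x * a + y * b" and e: "e * c = 1"
  shows "\<exists>v s t. v * u = 1 + s * x ^ n + t * y ^ n"
proof -
  obtain s t where st: "(x * a + y * b) ^ (2 * n) = s * (x * a) ^ n + t * (y * b) ^ n"
    using power_sum_in_power_ideal[of "x * a" "y * b" n] by blast
  have "c - u = - (x * a + y * b)" by (simp add: u)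
  then have "(c - u) ^ (2 * n) = (x * a + y * b) ^ (2 * n)"
    by (metis even_mult_iff even_two_times_div_two dvd_triv_left power_minus_even)
  moreover have "c ^ (2 * n) - (c - u) ^ (2 * n) = u * (\<Sum>i<2 * n. (c - u) ^ (2 * n - Suc i) * c ^ i)"
    using power_diff_sumr2[of c "2 * n" "c - u"] by simp
  ultimately obtain w where w: "w * u = c ^ (2 * n) - s * (x * a) ^ n - t * (y * b) ^ n"
    using st by (metis diff_diff_add mult.commute)
  have ec: "e ^ (2 * n) * c ^ (2 * n) = 1" using e by (simp flip: power_mult_distrib)
  have "(e ^ (2 * n) * w) * u = e ^ (2 * n) * (c ^ (2 * n) - s * (x * a) ^ n - t * (y * b) ^ n)"
    using w by (simp add: mult.assoc)
  also have "\<dots> = e ^ (2 * n) * c ^ (2 * n) + (- (e ^ (2 * n)) * s * a ^ n) * x ^ n + (- (e ^ (2 * n)) * t * b ^ n) * y ^ n"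
    by (simp add: algebra_simps power_mult_distrib)
  finally show ?thesis using ec by metis
qed

lemma unit_mod_coord_powers:
  fixes u :: "'a::field poly poly"
  assumes "value_at_origin u \<noteq> 0"
  shows "\<exists>v s t. v * u = 1 + s * coord_x ^ n + t * coord_y ^ n"
proof -
  obtain a b where "u = const2 (value_at_origin u) + coord_x * a + coord_y * b"
    using origin_decomposition by blast
  moreover have "const2 (inverse (value_at_origin u)) * const2 (value_at_origin u) = 1"
    using assms by (simp add: one_pCons)
  ultimately show ?thesis by (rule unit_mod_powers)
qed

text \<open>
  If the Tjurina ideal contains powers of both coordinates, then the polynomials that do not vanish at
  the origin are already units modulo it, so localization changes nothing.
\<close>

lemma local_tjurina_ideal_eq:
  assumes "coord_x ^ n \<in> tjurina_ideal f" "coord_y ^ n \<in> tjurina_ideal f"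
  shows "local_tjurina_ideal f = tjurina_ideal f"
proof
  show "local_tjurina_ideal f \<subseteq> tjurina_ideal f"
  proof
    fix g assume "g \<in> local_tjurina_ideal f"
    then obtain u where u: "value_at_origin u \<noteq> 0" "u * g \<in> tjurina_ideal f"
      by (auto simp: local_tjurina_ideal_def)
    obtain v s t where "v * u = 1 + s * coord_x ^ n + t * coord_y ^ n"
      using unit_mod_coord_powers[OF u(1)] by blast
    then have "v * (u * g) = (1 + s * coord_x ^ n + t * coord_y ^ n) * g" by (metis mult.assoc)
    then have "g = v * (u * g) + (- s * g) * coord_x ^ n + (- t * g) * coord_y ^ n"
      by (simp only: algebra_simps) simp
    moreover have "\<dots> \<in> tjurina_ideal f"
      by (intro tjurina_ideal_add tjurina_ideal_mult u assms)
    ultimately show "g \<in> tjurina_ideal f" by simp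
  qed
qed (use local_tjurina_ideal_superset in blast)

definition local_carrier :: "'a::field poly poly fract set" where
  "local_carrier = {Fract a b | a b. value_at_origin b \<noteq> 0}"

lemma local_ring_origin_eq: "local_ring_origin = ring_on local_carrier"
  by (simp add: local_ring_origin_def local_carrier_def value_at_origin_def)

lemma local_carrier_eq:
  "local_carrier = {to_fract a / to_fract b | a b. value_at_origin b \<noteq> 0}"
  by (simp add: local_carrier_def Fract_conv_to_fract)

lemma local_carrierI:
  "value_at_origin b \<noteq> 0 \<Longrightarrow> to_fract a / to_fract b \<in> local_carrier"
  by (auto simp: local_carrier_eq)

lemma to_fract_in_local_carrier: "to_fract a \<in> local_carrier"
  using local_carrierI[of 1 a] by simp

interpretation local_ring: type_subring "local_carrier :: 'a::field poly poly fract set"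
proof
  show "0 \<in> (local_carrier :: 'a poly poly fract set)" "1 \<in> (local_carrier :: 'a poly poly fract set)"
    using to_fract_in_local_carrier[of 0] to_fract_in_local_carrier[of 1] by simp_all
  fix x y :: "'a poly poly fract"
  assume "x \<in> local_carrier"
  then obtain a b where x: "x = to_fract a / to_fract b" "value_at_origin b \<noteq> 0"
    by (auto simp: local_carrier_eq)
  show "- x \<in> local_carrier"
    using local_carrierI[OF x(2), of "- a"] by (simp add: x)
  assume "y \<in> local_carrier"
  then obtain c d where y: "y = to_fract c / to_fract d" "value_at_origin d \<noteq> 0"
    by (auto simp: local_carrier_eq)
  have bd: "value_at_origin (b * d) \<noteq> 0" using x(2) y(2) by simp
  have nz: "to_fract b \<noteq> 0" "to_fract d \<noteq> 0" using x(2) y(2) by auto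
  have "x + y = to_fract (a * d + c * b) / to_fract (b * d)"
    using nz by (simp add: x y field_simps)
  then show "x + y \<in> local_carrier" using local_carrierI[OF bd] by metis
  have "x * y = to_fract (a * c) / to_fract (b * d)"
    by (simp add: x y)
  then show "x * y \<in> local_carrier" using local_carrierI[OF bd] by metis
qed

text \<open>
  The corresponding ideal of the local ring itself, as a set of fractions.
\<close>

definition local_tjurina_fract :: "'a::field poly poly \<Rightarrow> 'a poly poly fract set" where
  "local_tjurina_fract f = genideal local_ring_origin
     {to_fract f, to_fract (map_poly pderiv f), to_fract (pderiv f)}"

lemma ideal_local_tjurina_fract: "ideal (local_tjurina_fract f) (ring_on local_carrier)"
  unfolding local_tjurina_fract_def local_ring_origin_eq
  by (rule local_ring.genideal_ideal) (simp add: to_fract_in_local_carrier)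

text \<open>
  Clearing the denominators of the three cofactors multiplies the numerator by a polynomial that does
  not vanish at the origin.
\<close>

lemma to_fract_in_local_tjurina_fract_iff:
  "to_fract g \<in> local_tjurina_fract f \<longleftrightarrow> g \<in> local_tjurina_ideal f"
proof -
  note gen = local_ring.genideal_3_eq[OF to_fract_in_local_carrier to_fract_in_local_carrier
      to_fract_in_local_carrier, of f "map_poly pderiv f" "pderiv f", folded local_ring_origin_eq,
      folded local_tjurina_fract_def]
  note cl = local_ring.ideal_closed[OF ideal_local_tjurina_fract[of f]]
  show ?thesis
  proof
    assume "to_fract g \<in> local_tjurina_fract f"
    then obtain r s t where rst: "r \<in> local_carrier" "s \<in> local_carrier" "t \<in> local_carrier"
      and g: "to_fract g = r * to_fract f + s * to_fract (map_poly pderiv f) + t * to_fract (pderiv f)"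
      unfolding gen by auto
    obtain a a' b b' c c' where r: "r = to_fract a / to_fract a'" "value_at_origin a' \<noteq> 0"
      and s: "s = to_fract b / to_fract b'" "value_at_origin b' \<noteq> 0"
      and t: "t = to_fract c / to_fract c'" "value_at_origin c' \<noteq> 0"
      using rst unfolding local_carrier_eq by blast
    have nz: "to_fract a' \<noteq> 0" "to_fract b' \<noteq> 0" "to_fract c' \<noteq> 0" using r(2) s(2) t(2) by auto
    have "to_fract (a' * b' * c' * g) = to_fract ((a * b' * c') * f + (a' * b * c') * map_poly pderiv f
      + (a' * b' * c) * pderiv f)"
      using nz by (simp add: g r s t field_simps)
    then have "a' * b' * c' * g = (a * b' * c') * f + (a' * b * c') * map_poly pderiv f
      + (a' * b' * c) * pderiv f" by (simp only: to_fract_eq_iff)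
    then have "a' * b' * c' * g \<in> tjurina_ideal f" unfolding tjurina_ideal_def by blast
    moreover have "value_at_origin (a' * b' * c') \<noteq> 0" using r s t by simp
    ultimately show "g \<in> local_tjurina_ideal f" unfolding local_tjurina_ideal_def by blast
  next
    assume "g \<in> local_tjurina_ideal f"
    then obtain u a b c where u: "value_at_origin u \<noteq> 0"
      and g: "u * g = a * f + b * map_poly pderiv f + c * pderiv f"
      by (auto simp: local_tjurina_ideal_def tjurina_ideal_def)
    have nz: "to_fract u \<noteq> 0" using u by auto
    have "to_fract g = to_fract (u * g) / to_fract u" using nz by simp
    also have "\<dots> = (to_fract a / to_fract u) * to_fract f + (to_fract b / to_fract u) * to_fract (map_poly pderiv f)
      + (to_fract c / to_fract u) * to_fract (pderiv f)"
      unfolding g by (simp add: add_divide_distrib)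
    finally show "to_fract g \<in> local_tjurina_fract f"
      unfolding gen using local_carrierI[OF u] by blast
  qed
qed

interpretation local_ring: quotient_over_field
  "local_carrier :: 'a::field poly poly fract set" "local_tjurina_fract f" "\<lambda>c. to_fract (const2 c)"
  for f
  by (intro quotient_over_field.intro quotient_over_field_axioms.intro)
    (simp_all add: local_ring.type_subring_axioms ideal_local_tjurina_fract to_fract_in_local_carrier
       flip: one_pCons to_fract_add to_fract_mult)

lemma local_tjurina_eq:
  "local_tjurina f = quotient_dim (ring_on local_carrier) (\<lambda>c. to_fract (const2 c)) (local_tjurina_fract f)"
  by (simp add: local_tjurina_def local_tjurina_fract_def local_ring_origin_eq)


lemma coord_power_eq_monom:
  "coord_x ^ n = monom (monom (1::'a::comm_ring_1) n) 0" "coord_y ^ n = monom (monom (1::'a) 0) n"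
proof -
  have one: "monom (monom (1::'a) 0) 0 = 1" by (simp add: monom_0 one_pCons)
  have "monom (monom (1::'a) 1) 0 ^ n = monom (monom 1 n) 0"
    by (induction n) (simp_all add: mult_monom one)
  then show "coord_x ^ n = monom (monom (1::'a) n) 0" by (simp add: monom_0 monom_Suc)
  have "monom (monom (1::'a) 0) 1 ^ n = monom (monom 1 0) n"
    by (induction n) (simp_all add: mult_monom one)
  then show "coord_y ^ n = monom (monom (1::'a) 0) n" by (simp add: monom_0 monom_Suc one_pCons)
qed

text \<open>
  Modulo \<open>x^n\<close> and \<open>y^n\<close> only the monomials with both exponents below \<open>n\<close> remain.
\<close>

lemma truncation_mod_coord_powers:
  fixes g :: "'a::comm_ring_1 poly poly"
  shows "\<exists>c s t. g = (\<Sum>k\<in>{..<n} \<times> {..<n}. const2 (c k) * monom (monom 1 (fst k)) (snd k))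
    + s * coord_x ^ n + t * coord_y ^ n"
proof (induction g rule: poly2_monom_induct)
  case (monom a i j)
  let ?S = "\<lambda>c. \<Sum>k\<in>{..<n} \<times> {..<n}. const2 (c k) * monom (monom (1::'a) (fst k)) (snd k)"
  consider "i < n" "j < n" | "i \<ge> n" | "j \<ge> n" by linarith
  then show ?case
  proof cases
    case 1
    have "?S (\<lambda>k. if k = (i, j) then a else 0)
      = (\<Sum>k\<in>{..<n} \<times> {..<n}. if k = (i, j) then monom (monom a i) j else 0)"
      by (intro sum.cong) (auto simp: smult_monom)
    also have "\<dots> = monom (monom a i) j" using 1 by simp
    finally have "monom (monom a i) j = ?S (\<lambda>k. if k = (i, j) then a else 0) + 0 * coord_x ^ n + 0 * coord_y ^ n"
      by simp
    then show ?thesis by (intro exI)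
  next
    case 2
    have "monom (monom a i) j = ?S (\<lambda>_. 0) + monom (monom a (i - n)) j * coord_x ^ n + 0 * coord_y ^ n"
      using 2 by (simp add: coord_power_eq_monom mult_monom)
    then show ?thesis by (intro exI)
  next
    case 3
    have "monom (monom a i) j = ?S (\<lambda>_. 0) + 0 * coord_x ^ n + monom (monom a i) (j - n) * coord_y ^ n"
      using 3 by (simp add: coord_power_eq_monom mult_monom)
    then show ?thesis by (intro exI)
  qed
next
  case (add p q)
  let ?S = "\<lambda>c. \<Sum>k\<in>{..<n} \<times> {..<n}. const2 (c k) * monom (monom (1::'a) (fst k)) (snd k)"
  from add.IH(1) obtain c s t where "p = ?S c + s * coord_x ^ n + t * coord_y ^ n" by (elim exE)
  moreover from add.IH(2) obtain c' s' t' where "q = ?S c' + s' * coord_x ^ n + t' * coord_y ^ n"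
    by (elim exE)
  moreover have "?S (\<lambda>k. c k + c' k) = ?S c + ?S c'"
    unfolding sum.distrib[symmetric] by (intro sum.cong) (auto simp: smult_add_left simp flip: smult_add_left)
  ultimately have "p + q = ?S (\<lambda>k. c k + c' k) + (s + s') * coord_x ^ n + (t + t') * coord_y ^ n"
    by (simp only: distrib_right) (simp only: add_ac)
  then show ?case by (intro exI)
qed

lemma local_tjurina_ideal_mult: "g \<in> local_tjurina_ideal f \<Longrightarrow> h * g \<in> local_tjurina_ideal f"
  unfolding local_tjurina_ideal_def using tjurina_ideal_mult by (fastforce simp: mult.left_commute)

text \<open>
  A denominator has a polynomial inverse modulo \<open>x^n\<close> and \<open>y^n\<close>, hence modulo the ideal.
\<close>

lemma local_carrier_congruent_polynomial:
  assumes "coord_x ^ n \<in> local_tjurina_ideal f" "coord_y ^ n \<in> local_tjurina_ideal f"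
    and "r \<in> local_carrier"
  shows "\<exists>g. r - to_fract g \<in> local_tjurina_fract f"
proof -
  note cl = local_ring.ideal_closed[OF ideal_local_tjurina_fract[of f]]
  obtain a u where r: "r = to_fract a / to_fract u" "value_at_origin u \<noteq> 0"
    using assms(3) by (auto simp: local_carrier_eq)
  obtain v s t where v: "v * u = 1 + s * coord_x ^ n + t * coord_y ^ n"
    using unit_mod_coord_powers[OF r(2)] by blast
  have nz: "to_fract u \<noteq> 0" using r(2) by auto
  have "to_fract (v * a) - r = r * (to_fract (v * u) - 1)"
    using nz by (simp add: r field_simps)
  also have "\<dots> = r * (to_fract s * to_fract (coord_x ^ n) + to_fract t * to_fract (coord_y ^ n))"
    unfolding v by (simp only: to_fract_add to_fract_mult to_fract_1) simp
  also have "\<dots> \<in> local_tjurina_fract f"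
    using assms by (intro cl(3,4) to_fract_in_local_carrier) (simp_all only: to_fract_in_local_tjurina_fract_iff)
  finally have "0 - (to_fract (v * a) - r) \<in> local_tjurina_fract f"
    by (rule cl(5)[OF cl(2)])
  then show ?thesis by (intro exI[of _ "v * a"]) simp
qed

lemma local_tjurina_finite:
  assumes "coord_x ^ n \<in> tjurina_ideal f" "coord_y ^ n \<in> tjurina_ideal f"
  shows "local_tjurina f \<noteq> \<infinity>"
  unfolding local_tjurina_eq
proof (rule local_ring.finite_quotient_dim)
  let ?T = "{..<n} \<times> {..<n}" and ?b = "\<lambda>k. to_fract (monom (monom 1 (fst k)) (snd k))"
  show "finite ?T" by simp
  show "?b ` ?T \<subseteq> local_carrier" using to_fract_in_local_carrier by blast
  fix r :: "'a poly poly fract" assume "r \<in> local_carrier"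
  note cl = local_ring.ideal_closed[OF ideal_local_tjurina_fract[of f]]
  note pow = assms[THEN local_tjurina_ideal_superset]
  obtain g where g: "r - to_fract g \<in> local_tjurina_fract f"
    using local_carrier_congruent_polynomial[OF pow \<open>r \<in> local_carrier\<close>] by blast
  obtain c s t where c: "g = (\<Sum>k\<in>?T. const2 (c k) * monom (monom 1 (fst k)) (snd k))
    + s * coord_x ^ n + t * coord_y ^ n"
    using truncation_mod_coord_powers[of g n] by (elim exE)
  let ?S = "\<Sum>k\<in>?T. to_fract (const2 (c k)) * ?b k"
  have "to_fract g - ?S = to_fract s * to_fract (coord_x ^ n) + to_fract t * to_fract (coord_y ^ n)"
    by (subst c) (simp only: to_fract_add to_fract_mult to_fract_sum, simp)
  also have "\<dots> \<in> local_tjurina_fract f"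
    using pow by (intro cl(3,4) to_fract_in_local_carrier) (simp_all only: to_fract_in_local_tjurina_fract_iff)
  finally have "(r - to_fract g) + (to_fract g - ?S) \<in> local_tjurina_fract f"
    using g cl(3) by blast
  then show "\<exists>c. r - (\<Sum>k\<in>?T. to_fract (const2 (c k)) * ?b k) \<in> local_tjurina_fract f"
    by (intro exI[of _ c]) simp
qed

lemma combination_in_local_tjurina_fract_iff:
  "(\<Sum>t\<in>T. to_fract (const2 (c t)) * to_fract (b t)) \<in> local_tjurina_fract f \<longleftrightarrow>
    (\<Sum>t\<in>T. const2 (c t) * b t) \<in> local_tjurina_ideal f"
  by (subst to_fract_in_local_tjurina_fract_iff[symmetric]) (simp only: to_fract_sum to_fract_mult)

lemma card_le_local_tjurina:
  assumes "local_tjurina f = enat \<tau>" "finite T"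
    and "\<And>c. (\<Sum>t\<in>T. const2 (c t) * b t) \<in> local_tjurina_ideal f \<Longrightarrow> \<forall>t\<in>T. c t = 0"
  shows "card T \<le> \<tau>"
proof (rule local_ring.independent_card_le_quotient_dim[OF assms(1)[unfolded local_tjurina_eq]])
  show "local_ring.independent_mod f T (\<lambda>t. to_fract (b t))"
    unfolding local_ring.independent_mod_def combination_in_local_tjurina_fract_iff
    using assms(2,3) to_fract_in_local_carrier by blast
qed

text \<open>
  The \<open>\<tau> + 1\<close> elements \<open>1, z, \<dots>, z^\<tau>\<close> satisfy a linear relation modulo the ideal. If \<open>z^k\<close> is the
  lowest power in it, the relation is \<open>z^k\<close> times a polynomial \<open>w\<close> whose value at the origin is the
  coefficient of \<open>z^k\<close>. So \<open>w\<close> is a unit of the local ring.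
\<close>

lemma power_in_local_tjurina_ideal:
  assumes "local_tjurina f = enat \<tau>" and z: "value_at_origin z = 0"
  shows "z ^ \<tau> \<in> local_tjurina_ideal f"
proof -
  have "\<not> (\<forall>c. (\<Sum>i\<in>{..\<tau>}. const2 (c i) * z ^ i) \<in> local_tjurina_ideal f \<longrightarrow> (\<forall>i\<in>{..\<tau>}. c i = 0))"
    using card_le_local_tjurina[OF assms(1), of "{..\<tau>}" "\<lambda>i. z ^ i"] by auto
  then obtain c where c: "(\<Sum>i\<le>\<tau>. const2 (c i) * z ^ i) \<in> local_tjurina_ideal f" "\<exists>i\<le>\<tau>. c i \<noteq> 0"
    by auto
  define k where "k = (LEAST i. c i \<noteq> 0)"
  have ck: "c k \<noteq> 0" and kmin: "\<And>i. i < k \<Longrightarrow> c i = 0"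
    using c(2) not_less_Least LeastI_ex[of "\<lambda>i. c i \<noteq> 0"] unfolding k_def by blast+
  have k: "k \<le> \<tau>" using c(2) kmin by (meson le_trans linorder_not_less)
  define w where "w = (\<Sum>i\<in>{k..\<tau>}. const2 (c i) * z ^ (i - k))"
  have "(\<Sum>i\<le>\<tau>. const2 (c i) * z ^ i) = (\<Sum>i\<in>{k..\<tau>}. const2 (c i) * z ^ i)"
    using kmin by (intro sum.mono_neutral_right) (auto simp: not_le)
  also have "\<dots> = w * z ^ k"
    unfolding w_def sum_distrib_right mult.assoc power_add[symmetric] by (intro sum.cong) auto
  finally obtain u where u: "value_at_origin u \<noteq> 0" "u * (w * z ^ k) \<in> tjurina_ideal f"
    using c(1) by (auto simp: local_tjurina_ideal_def)
  have "value_at_origin w = (\<Sum>i\<in>{k..\<tau>}. if i = k then c k else 0)"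
    unfolding w_def is_ring_hom_sum[OF value_at_origin_hom]
    by (intro sum.cong) (auto simp: z simp del: mult_pCons_left)
  also have "\<dots> = c k" using k by simp
  finally have "value_at_origin (u * w) \<noteq> 0" using u(1) ck by simp
  then have "z ^ k \<in> local_tjurina_ideal f"
    using u(2) unfolding local_tjurina_ideal_def mult.assoc[symmetric] by blast
  then show ?thesis
    using local_tjurina_ideal_mult[of "z ^ k" f "z ^ (\<tau> - k)"] k by (simp flip: power_add)
qed

text \<open>
  By \<open>power_in_local_tjurina_ideal\<close>, the ideal contains powers of both coordinates, so an independent
  family of fractions can be replaced by congruent polynomials.
\<close>

lemma local_tjurina_basis:
  assumes "local_tjurina f = enat \<tau>"
  shows "\<exists>b. \<forall>c. (\<Sum>i<\<tau>. const2 (c i) * b i) \<in> local_tjurina_ideal f \<longrightarrow> (\<forall>i<\<tau>. c i = 0)"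
proof -
  note cl = local_ring.ideal_closed[OF ideal_local_tjurina_fract[of f]]
  obtain r where "local_ring.independent_mod f {..<\<tau>} r"
    using local_ring.quotient_dim_eq_imp_independent[OF assms[unfolded local_tjurina_eq]] by blast
  then have r: "\<And>i. i < \<tau> \<Longrightarrow> r i \<in> local_carrier"
    and ind: "\<And>c. (\<Sum>i<\<tau>. to_fract (const2 (c i)) * r i) \<in> local_tjurina_fract f \<Longrightarrow> \<forall>i<\<tau>. c i = 0"
    unfolding local_ring.independent_mod_def by auto
  have "\<exists>g. r i - to_fract g \<in> local_tjurina_fract f" if "i < \<tau>" for i
    using local_carrier_congruent_polynomial[OF _ _ r[OF that]]
      power_in_local_tjurina_ideal[OF assms value_at_origin_coord(1)]
      power_in_local_tjurina_ideal[OF assms value_at_origin_coord(2)] by blast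
  then obtain b where b: "\<And>i. i < \<tau> \<Longrightarrow> r i - to_fract (b i) \<in> local_tjurina_fract f" by metis
  have "\<forall>i<\<tau>. c i = 0" if c: "(\<Sum>i<\<tau>. const2 (c i) * b i) \<in> local_tjurina_ideal f" for c
  proof (rule ind)
    have *: "(\<Sum>i\<in>A. to_fract (const2 (c i)) * (r i - to_fract (b i))) \<in> local_tjurina_fract f"
      if "A \<subseteq> {..<\<tau>}" for A
      using finite_subset[OF that finite_lessThan] that
      by (induction A rule: finite_induct) (auto simp: cl(2) intro!: cl(3,4) b to_fract_in_local_carrier)
    have "(\<Sum>i<\<tau>. to_fract (const2 (c i)) * r i) =
      (\<Sum>i<\<tau>. to_fract (const2 (c i)) * (r i - to_fract (b i))) + (\<Sum>i<\<tau>. to_fract (const2 (c i)) * to_fract (b i))"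
      by (simp add: sum.distrib[symmetric] right_diff_distrib)
    also have "\<dots> \<in> local_tjurina_fract f"
      using *[OF order_refl] c unfolding combination_in_local_tjurina_fract_iff[symmetric] by (rule cl(3))
    finally show "(\<Sum>i<\<tau>. to_fract (const2 (c i)) * r i) \<in> local_tjurina_fract f" .
  qed
  then show ?thesis by blast
qed

text \<open>
  An element of the ideal that does not vanish at the origin is a unit of the local ring, which would
  make the Tjurina algebra zero.
\<close>

lemma value_at_origin_eq_0_if_local_tjurina_pos:
  assumes "local_tjurina f > 0" and "g \<in> tjurina_ideal f"
  shows "value_at_origin g = 0"
proof (rule ccontr)
  assume "value_at_origin g \<noteq> 0"
  then have "1 \<in> local_tjurina_ideal f"
    using assms(2) unfolding local_tjurina_ideal_def by auto
  then have "1 \<in> local_tjurina_fract f" using to_fract_in_local_tjurina_fract_iff[of 1 f] by simp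
  then have "local_tjurina f = 0" unfolding local_tjurina_eq by (rule local_ring.zero_ring(1))
  with assms(1) show False by simp
qed

text \<open>
  In a quotient of dimension \<open>0\<close> the family with the single element \<open>1\<close> is dependent.
\<close>

lemma one_in_tjurina_ideal_if_affine_tjurina_0:
  assumes "affine_tjurina h = 0" shows "1 \<in> tjurina_ideal h"
proof -
  define I where "I = genideal (ring_on UNIV) {h, map_poly pderiv h, pderiv h}"
  have I: "I = tjurina_ideal h"
    unfolding I_def type_ring.genideal_3_eq[OF UNIV_I UNIV_I UNIV_I] by (simp add: tjurina_ideal_def)
  have "ideal I (ring_on UNIV)" unfolding I_def by (rule type_ring.genideal_ideal) simp
  then interpret q: quotient_over_field UNIV I const2
    by (intro quotient_over_field.intro quotient_over_field_axioms.intro)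
      (simp_all add: type_ring.type_subring_axioms flip: one_pCons)
  have "quotient_dim (ring_on UNIV) const2 I = enat 0"
    using assms by (simp add: affine_tjurina_def I_def ring_on_UNIV zero_enat_def)
  then have "\<not> q.independent_mod {()} (\<lambda>_. 1)"
    using q.independent_card_le_quotient_dim by fastforce
  then obtain c where c: "const2 c \<in> tjurina_ideal h" "c \<noteq> 0"
    unfolding q.independent_mod_def by (auto simp: I)
  have "const2 (inverse c) * const2 c \<in> tjurina_ideal h" by (rule tjurina_ideal_mult[OF c(1)])
  then show ?thesis using c(2) by (simp add: one_pCons)
qed


section \<open>Jacobian forms and the local Tjurina algebra\<close>

lemma homogeneous_power:
  fixes z :: "'a::comm_ring_1 poly3"
  assumes "homogeneous 1 z" shows "homogeneous n (z ^ n)"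
proof (induction n)
  case 0
  show ?case using homogeneous_mono3[of 0 0 0 0 "1::'a"] by (simp add: mono3_def monom_0 one_pCons)
next
  case (Suc n)
  then show ?case using homogeneous_mult[OF assms Suc] by simp
qed

text \<open>
  The cofactors in the chart are homogenized to the right degrees. The resulting form and \<open>z^m H\<close>
  have the same degree and the same dehomogenization, so they are equal.
\<close>

lemma (in affine_chart) multiple_in_jacobian_forms:
  assumes F: "homogeneous d F" "d > 0" and H: "homogeneous l H"
    and eq: "h H = a * h F + b * h (partialX F) + c * h (partialY F) + e * h (partialZ F)"
  shows "\<exists>M. \<forall>m\<ge>M. z ^ m * H \<in> jacobian_forms d F (m + l)"
proof -
  note h = is_ring_hom_sel[OF is_ring_hom]
  have "\<forall>p\<in>{a, b, c, e}. \<forall>\<^sub>F n in sequentially. \<exists>P. homogeneous n P \<and> h P = p"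
    unfolding eventually_sequentially using homogenization by blast
  then have "\<forall>\<^sub>F n in sequentially. \<forall>p\<in>{a, b, c, e}. \<exists>P. homogeneous n P \<and> h P = p"
    by (intro eventually_ball_finite) auto
  then obtain k where k: "\<And>n p. n \<ge> k \<Longrightarrow> p \<in> {a, b, c, e} \<Longrightarrow> \<exists>P. homogeneous n P \<and> h P = p"
    unfolding eventually_sequentially by blast
  have "z ^ m * H \<in> jacobian_forms d F (m + l)" if m: "m \<ge> d + k" for m
  proof -
    define r where "r = m + l - d"
    have r: "r \<ge> k" "Suc r \<ge> k" "m + l = d + r" using m by (auto simp: r_def)
    obtain A where A: "homogeneous r A" "h A = a" using k[OF r(1), of a] by blast
    obtain B where B: "homogeneous (Suc r) B" "h B = b" using k[OF r(2), of b] by blast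
    obtain C where C: "homogeneous (Suc r) C" "h C = c" using k[OF r(2), of c] by blast
    obtain E where E: "homogeneous (Suc r) E" "h E = e" using k[OF r(2), of e] by blast
    let ?P = "A * F + B * partialX F + C * partialY F + E * partialZ F"
    have P: "?P \<in> jacobian_forms d F (m + l)"
      by (rule jacobian_formsI[OF r(3) A(1) B(1) C(1) E(1)])
    then have "homogeneous (m + l) ?P" using jacobian_forms_homogeneous[OF F] by blast
    moreover have "homogeneous (m + l) (z ^ m * H)"
      by (intro homogeneous_mult homogeneous_power homogeneous_z H)
    ultimately have "homogeneous (m + l) (z ^ m * H - ?P)"
      by (intro homogeneous_diff)
    moreover have "h (z ^ m * H - ?P) = 0"
      by (simp add: h z_eq_1 eq A(2) B(2) C(2) E(2))
    ultimately have "z ^ m * H = ?P" using eq_0 by (metis eq_iff_diff_eq_0)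
    then show ?thesis using P by metis
  qed
  then show ?thesis by blast
qed

text \<open>
  The case \<open>H = 1\<close>: a vanishing Tjurina number in the chart means that \<open>1\<close> is a
  combination of the dehomogenized generators.
\<close>

lemma power_X_in_jacobian_forms:
  fixes F :: "'a::field poly3"
  assumes F: "homogeneous d F" "d > 0" and "tjurina_X_nonzero F = 0"
  shows "\<exists>n. varX ^ n \<in> jacobian_forms d F n"
proof -
  have "affine_tjurina (at_X F) = 0" using assms(3) by (simp add: tjurina_X_nonzero_def at_X_def)
  then obtain a c e where "1 = a * at_X F + c * at_X (partialY F) + e * at_X (partialZ F)"
    using one_in_tjurina_ideal_if_affine_tjurina_0[of "at_X F"]
    by (auto simp: tjurina_ideal_def at_partial)
  then have "at_X 1 = a * at_X F + 0 * at_X (partialX F) + c * at_X (partialY F) + e * at_X (partialZ F)"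
    by (simp add: is_ring_hom_sel[OF is_ring_hom_at(1)])
  from chart_X.multiple_in_jacobian_forms[OF F homogeneous_power[OF chart_X.homogeneous_z, of 0, simplified] this]
  obtain M where "\<And>m. m \<ge> M \<Longrightarrow> varX ^ m * 1 \<in> jacobian_forms d F (m + 0)" by blast
  then show ?thesis using le_refl by (metis add.right_neutral mult.right_neutral)
qed

lemma power_Y_in_jacobian_forms:
  fixes F :: "'a::field poly3"
  assumes F: "homogeneous d F" "d > 0" and "tjurina_Y_nonzero F = 0"
  shows "\<exists>n. varY ^ n \<in> jacobian_forms d F n"
proof -
  have "affine_tjurina (at_Y F) = 0" using assms(3) by (simp add: tjurina_Y_nonzero_def at_Y_def)
  then obtain a b e where "1 = a * at_Y F + b * at_Y (partialX F) + e * at_Y (partialZ F)"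
    using one_in_tjurina_ideal_if_affine_tjurina_0[of "at_Y F"]
    by (auto simp: tjurina_ideal_def at_partial)
  then have "at_Y 1 = a * at_Y F + b * at_Y (partialX F) + 0 * at_Y (partialY F) + e * at_Y (partialZ F)"
    by (simp add: is_ring_hom_sel[OF is_ring_hom_at(2)])
  from chart_Y.multiple_in_jacobian_forms[OF F homogeneous_power[OF chart_Y.homogeneous_z, of 0, simplified] this]
  obtain M where "\<And>m. m \<ge> M \<Longrightarrow> varY ^ m * 1 \<in> jacobian_forms d F (m + 0)" by blast
  then show ?thesis using le_refl by (metis add.right_neutral mult.right_neutral)
qed

lemmas at_Z_simps = is_ring_hom_sel[OF is_ring_hom_at(3)]

lemma at_Z_var: "at_Z varX = coord_x" "at_Z varY = coord_y" "at_Z varZ = 1"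
  by (simp_all add: at_Z_def varX_def varY_def varZ_def)

lemma at_Z_scale3: "at_Z (scale3 c P) = const2 c * at_Z P"
  by (simp add: at_Z_def scale3_def)

text \<open>
  The derivative with respect to \<open>Z\<close> is not among the generators of the Tjurina ideal in the chart
  \<open>Z \<noteq> 0\<close>; it is recovered from Euler's identity at \<open>Z = 1\<close>.
\<close>

lemma at_Z_partials_in_tjurina_ideal:
  fixes F :: "'a::field poly3"
  assumes "homogeneous d F"
  shows "at_Z (partialX F) \<in> tjurina_ideal (at_Z F)" "at_Z (partialY F) \<in> tjurina_ideal (at_Z F)"
    "at_Z (partialZ F) \<in> tjurina_ideal (at_Z F)"
proof -
  show x: "at_Z (partialX F) \<in> tjurina_ideal (at_Z F)" and y: "at_Z (partialY F) \<in> tjurina_ideal (at_Z F)"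
    unfolding at_partial by (rule tjurina_ideal_generators)+
  have "coord_x * at_Z (partialX F) + coord_y * at_Z (partialY F) + at_Z (partialZ F)
    = of_nat d * at_Z F"
    using arg_cong[OF euler_identity[OF assms], of at_Z]
    by (simp only: at_Z_simps at_Z_var mult_1)
  then have "at_Z (partialZ F) = of_nat d * at_Z F + (- coord_x) * at_Z (partialX F)
    + (- coord_y) * at_Z (partialY F)"
    by (simp only: mult_minus_left) (metis (no_types, lifting) add.commute add.assoc add_diff_cancel_left' diff_conv_add_uminus minus_add_distrib)
  also have "\<dots> \<in> tjurina_ideal (at_Z F)"
    by (intro tjurina_ideal_add tjurina_ideal_mult x y tjurina_ideal_generators)
  finally show "at_Z (partialZ F) \<in> tjurina_ideal (at_Z F)" .
qed

lemma at_Z_jacobian_forms: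
  assumes "homogeneous d F" "P \<in> jacobian_forms d F n"
  shows "at_Z P \<in> tjurina_ideal (at_Z F)"
  using assms(2) at_Z_partials_in_tjurina_ideal[OF assms(1)]
  unfolding jacobian_forms_def
  by (auto simp: at_Z_simps intro!: tjurina_ideal_add tjurina_ideal_mult tjurina_ideal_generators(1))

lemma power_var_in_jacobian_forms_mono:
  assumes "varX ^ m \<in> jacobian_forms d F m" "varY ^ m' \<in> jacobian_forms d F m'"
  shows "varX ^ max m m' \<in> jacobian_forms d F (max m m')"
    "varY ^ max m m' \<in> jacobian_forms d F (max m m')"
proof -
  let ?n = "max m m'"
  have "homogeneous (?n - m) (varX ^ (?n - m) :: 'a poly3)" "homogeneous (?n - m') (varY ^ (?n - m') :: 'a poly3)"
    by (simp_all add: var_power homogeneous_mono3)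
  from jacobian_forms_mult[OF assms(1) this(1)] jacobian_forms_mult[OF assms(2) this(2)]
  show "varX ^ ?n \<in> jacobian_forms d F ?n" "varY ^ ?n \<in> jacobian_forms d F ?n"
    by (simp_all flip: power_add)
qed

lemma mult_scale3: "Q * scale3 c P = scale3 c (Q * P)"
  by (simp add: scale3_def)

text \<open>
  A monomial in degree \<open>m + 2 N\<close> whose exponents of \<open>X\<close> and \<open>Y\<close> are both below \<open>N\<close> is divisible by
  \<open>Z^m\<close>, and all others lie in the Jacobian ideal. This reduces forms of any large degree to forms of
  the fixed degree \<open>2 N\<close>.
\<close>

lemma forms_mod_jacobian_forms:
  fixes F :: "'a::field poly3"
  assumes X: "varX ^ N \<in> jacobian_forms d F N" and Y: "varY ^ N \<in> jacobian_forms d F N"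
    and n: "n = m + 2 * N" "d \<le> n" and "homogeneous n G"
  shows "\<exists>H. homogeneous (2 * N) H \<and> G - varZ ^ m * H \<in> jacobian_forms d F n"
proof -
  note J = poly3.subspace_0[OF subspace_jacobian_forms[OF n(2)]]
    poly3.subspace_add[OF subspace_jacobian_forms[OF n(2)]]
    poly3.subspace_scale[OF subspace_jacobian_forms[OF n(2)]]
  let ?V = "{G. \<exists>H. homogeneous (2 * N) H \<and> G - varZ ^ m * H \<in> jacobian_forms d F n}"
  have "poly3.subspace ?V"
  proof (rule poly3.subspaceI)
    show "0 \<in> ?V" using J(1) by (auto intro!: exI[of _ 0])
  next
    fix P Q assume "P \<in> ?V" "Q \<in> ?V"
    then obtain H H' where H: "homogeneous (2 * N) H" "homogeneous (2 * N) H'"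
      "P - varZ ^ m * H \<in> jacobian_forms d F n" "Q - varZ ^ m * H' \<in> jacobian_forms d F n" by blast
    have "P + Q - varZ ^ m * (H + H') = (P - varZ ^ m * H) + (Q - varZ ^ m * H')"
      by (simp add: algebra_simps)
    then have "P + Q - varZ ^ m * (H + H') \<in> jacobian_forms d F n"
      using J(2)[OF H(3,4)] by (simp only:)
    then show "P + Q \<in> ?V" using homogeneous_add[OF H(1,2)] by blast
  next
    fix c P assume "P \<in> ?V"
    then obtain H where H: "homogeneous (2 * N) H" "P - varZ ^ m * H \<in> jacobian_forms d F n" by blast
    have "scale3 c P - varZ ^ m * scale3 c H = scale3 c (P - varZ ^ m * H)"
      by (simp add: mult_scale3 poly3.scale_right_diff_distrib)
    then have "scale3 c P - varZ ^ m * scale3 c H \<in> jacobian_forms d F n"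
      using J(3)[OF H(2)] by simp
    then show "scale3 c P \<in> ?V" using homogeneous_scale3[OF H(1)] by blast
  qed
  moreover have nN: "n - N + N = n" using n(1) by simp
  have "monomials n \<subseteq> ?V"
  proof
    fix P :: "'a poly3" assume "P \<in> monomials n"
    then obtain i j k where P: "P = mono3 1 i j k" and ijk: "i + j + k = n"
      by (auto simp: monomials_def exponents_def)
    consider "i \<ge> N" | "j \<ge> N" | "k \<ge> m" using ijk n(1) by linarith
    then show "P \<in> ?V"
    proof cases
      case 1
      have "homogeneous (n - N) (mono3 (1::'a) (i - N) j k)" using 1 ijk by (intro homogeneous_mono3) simp
      from jacobian_forms_mult[OF X this] have "P \<in> jacobian_forms d F n"
        unfolding nN using 1 by (simp add: P var_power mono3_mult)
      then show ?thesis by (auto intro!: exI[of _ 0])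
    next
      case 2
      have "homogeneous (n - N) (mono3 (1::'a) i (j - N) k)" using 2 ijk by (intro homogeneous_mono3) simp
      from jacobian_forms_mult[OF Y this] have "P \<in> jacobian_forms d F n"
        unfolding nN using 2 by (simp add: P var_power mono3_mult)
      then show ?thesis by (auto intro!: exI[of _ 0])
    next
      case 3
      have "homogeneous (2 * N) (mono3 (1::'a) i j (k - m))" using 3 ijk n by (intro homogeneous_mono3) simp
      moreover have "P - varZ ^ m * mono3 1 i j (k - m) = 0"
        using 3 by (simp add: P var_power mono3_mult)
      ultimately show ?thesis using J(1) by (metis (mono_tags, lifting) mem_Collect_eq)
    qed
  qed
  ultimately have "poly3.span (monomials n) \<subseteq> ?V" by (intro poly3.span_minimal)
  then show ?thesis using homogeneous_in_span[of n] assms(5) by blast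
qed

text \<open>
  The exponent in \<open>multiple_in_jacobian_forms\<close> depends on \<open>H\<close>. It can be chosen for all \<open>H\<close> of a fixed
  degree at once, because these span a finite-dimensional space.
\<close>

lemma uniform_multiple_in_jacobian_forms:
  fixes F :: "'a::field poly3"
  assumes F: "homogeneous d F" "d > 0"
  shows "\<exists>M. \<forall>m\<ge>M. \<forall>H. homogeneous l H \<and> at_Z H \<in> tjurina_ideal (at_Z F) \<longrightarrow>
    varZ ^ m * H \<in> jacobian_forms d F (m + l)"
proof -
  let ?K = "{H. homogeneous l H \<and> at_Z H \<in> tjurina_ideal (at_Z F)}"
  obtain B where B: "B \<subseteq> ?K" "poly3.independent B" "?K \<subseteq> poly3.span B"
    by (rule poly3.maximal_independent_subset[of ?K])
  have "B \<subseteq> poly3.span (monomials l)" using B(1) homogeneous_in_span[of l] by blast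
  then have "finite B" using poly3.independent_span_bound[OF finite_monomials B(2)] by blast
  moreover have "\<forall>H\<in>B. eventually (\<lambda>m. varZ ^ m * H \<in> jacobian_forms d F (m + l)) sequentially"
  proof
    fix H assume "H \<in> B"
    then obtain a b c where H: "homogeneous l H"
      and abc: "at_Z H = a * at_Z F + b * at_Z (partialX F) + c * at_Z (partialY F)"
      using B(1) by (auto simp: tjurina_ideal_def at_partial)
    then have "at_Z H = a * at_Z F + b * at_Z (partialX F) + c * at_Z (partialY F) + 0 * at_Z (partialZ F)"
      by simp
    then show "eventually (\<lambda>m. varZ ^ m * H \<in> jacobian_forms d F (m + l)) sequentially"
      unfolding eventually_sequentially by (rule chart_Z.multiple_in_jacobian_forms[OF F H])
  qed
  ultimately have "eventually (\<lambda>m. \<forall>H\<in>B. varZ ^ m * H \<in> jacobian_forms d F (m + l)) sequentially"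
    by (simp add: eventually_ball_finite)
  then obtain M where M: "\<And>m H. m \<ge> M \<Longrightarrow> H \<in> B \<Longrightarrow> varZ ^ m * H \<in> jacobian_forms d F (m + l)"
    by (auto simp: eventually_sequentially)
  \<comment> \<open>\<open>m \<ge> d\<close> makes the target a subspace, so that it suffices to treat the basis\<close>
  have "varZ ^ m * H \<in> jacobian_forms d F (m + l)" if m: "m \<ge> max M d" and H: "H \<in> ?K" for m H
  proof -
    have dl: "d \<le> m + l" using m by simp
    note J = subspace_jacobian_forms[OF dl, of F]
    have "poly3.subspace {H. varZ ^ m * H \<in> jacobian_forms d F (m + l)}"
    proof (rule poly3.subspaceI)
      fix c P assume "P \<in> {H. varZ ^ m * H \<in> jacobian_forms d F (m + l)}"
      then have "scale3 c (varZ ^ m * P) \<in> jacobian_forms d F (m + l)"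
        using poly3.subspace_scale[OF J] by simp
      then show "scale3 c P \<in> {H. varZ ^ m * H \<in> jacobian_forms d F (m + l)}"
        by (simp add: scale3_def mult.left_commute del: mult_pCons_left)
    qed (use poly3.subspace_0[OF J] poly3.subspace_add[OF J] in \<open>auto simp: distrib_left\<close>)
    then have "poly3.span B \<subseteq> {H. varZ ^ m * H \<in> jacobian_forms d F (m + l)}"
      using M m by (intro poly3.span_minimal) auto
    then show ?thesis using H B(3) by blast
  qed
  then show ?thesis by (intro exI[of _ "max M d"]) blast
qed

lemma at_Z_sum_scale3: "at_Z (\<Sum>t\<in>T. scale3 (c t) (b t)) = (\<Sum>t\<in>T. const2 (c t) * at_Z (b t))"
  by (simp only: is_ring_hom_sum[OF is_ring_hom_at(3)] at_Z_scale3)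

text \<open>
  For large \<open>n\<close>, dehomogenization is injective on \<open>S\<^sub>n / J\<^sub>n\<close>. Every form in \<open>D\<close> is congruent to
  \<open>Z^m H\<close> with \<open>H\<close> of degree \<open>2 N\<close>. If a combination of the \<open>H\<close> dehomogenizes into the local Tjurina
  ideal, then it dehomogenizes into the Tjurina ideal itself, since powers of both coordinates are
  there. Its product with \<open>Z^m\<close> is then in the Jacobian ideal, and so is the same combination of the
  elements of \<open>D\<close>.
\<close>

lemma codimension_jacobian_forms_le:
  fixes F :: "'a::field poly3"
  assumes F: "homogeneous d F" "d > 0"
    and X: "varX ^ N \<in> jacobian_forms d F N" and Y: "varY ^ N \<in> jacobian_forms d F N"
    and tau: "local_tjurina (at_Z F) = enat \<tau>"
  shows "\<exists>n0. \<forall>n\<ge>n0. \<forall>D. D \<subseteq> {P. homogeneous n P} \<and>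
    poly3.family_independent_mod (jacobian_forms d F n) D (\<lambda>P. P) \<longrightarrow> card D \<le> \<tau>"
proof -
  let ?J = "jacobian_forms d F"
  obtain M where M: "\<And>m H. m \<ge> M \<Longrightarrow> homogeneous (2 * N) H \<Longrightarrow> at_Z H \<in> tjurina_ideal (at_Z F) \<Longrightarrow>
    varZ ^ m * H \<in> ?J (m + 2 * N)"
    using uniform_multiple_in_jacobian_forms[OF F, of "2 * N"] by metis
  have local_eq: "local_tjurina_ideal (at_Z F) = tjurina_ideal (at_Z F)"
    using at_Z_jacobian_forms[OF F(1) X] at_Z_jacobian_forms[OF F(1) Y]
    by (intro local_tjurina_ideal_eq[of N]) (simp_all only: at_Z_simps at_Z_var)
  have "card D \<le> \<tau>" if n: "n \<ge> M + 2 * N + d" and D: "D \<subseteq> {P. homogeneous n P}"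
    and ind: "poly3.family_independent_mod (?J n) D (\<lambda>P. P)" for n D
  proof -
    define m where "m = n - 2 * N"
    have m: "n = m + 2 * N" "m \<ge> M" "d \<le> n" using n by (auto simp: m_def)
    note J = subspace_jacobian_forms[OF m(3), of F]
    obtain H where H: "\<And>P. P \<in> D \<Longrightarrow> homogeneous (2 * N) (H P)"
      "\<And>P. P \<in> D \<Longrightarrow> P - varZ ^ m * H P \<in> ?J n"
      using forms_mod_jacobian_forms[OF X Y m(1,3)] D by (metis mem_Collect_eq subsetD)
    show ?thesis
    proof (rule card_le_local_tjurina[OF tau, of D "\<lambda>P. at_Z (H P)"])
      show "finite D" using ind by (simp add: poly3.family_independent_mod_def)
      fix c assume "(\<Sum>P\<in>D. const2 (c P) * at_Z (H P)) \<in> local_tjurina_ideal (at_Z F)"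
      then have "at_Z (\<Sum>P\<in>D. scale3 (c P) (H P)) \<in> tjurina_ideal (at_Z F)"
        by (simp only: local_eq at_Z_sum_scale3)
      moreover have "homogeneous (2 * N) (\<Sum>P\<in>D. scale3 (c P) (H P))"
        using poly3.subspace_sum[OF subspace_homogeneous, of D "\<lambda>P. scale3 (c P) (H P)" "2 * N"]
        by (simp add: H(1) homogeneous_scale3)
      ultimately have "varZ ^ m * (\<Sum>P\<in>D. scale3 (c P) (H P)) \<in> ?J n"
        using M[OF m(2)] m(1) by blast
      moreover have "(\<Sum>P\<in>D. scale3 (c P) (P - varZ ^ m * H P)) \<in> ?J n"
        by (intro poly3.subspace_sum[OF J] poly3.subspace_scale[OF J] H(2))
      ultimately have "varZ ^ m * (\<Sum>P\<in>D. scale3 (c P) (H P)) + (\<Sum>P\<in>D. scale3 (c P) (P - varZ ^ m * H P)) \<in> ?J n"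
        by (rule poly3.subspace_add[OF J])
      also have "varZ ^ m * (\<Sum>P\<in>D. scale3 (c P) (H P)) + (\<Sum>P\<in>D. scale3 (c P) (P - varZ ^ m * H P))
        = (\<Sum>P\<in>D. scale3 (c P) P)"
        unfolding sum_distrib_left sum.distrib[symmetric]
        by (intro sum.cong) (simp_all add: mult_scale3 poly3.scale_right_diff_distrib)
      finally show "\<forall>P\<in>D. c P = 0" using poly3.family_independent_modD[OF ind] by blast
    qed
  qed
  then show ?thesis by (intro exI[of _ "M + 2 * N + d"]) blast
qed

text \<open>
  The kernel of the map from the forms of degree \<open>n\<close> to the local Tjurina algebra at \<open>(0:0:1)\<close>.
\<close>

definition local_jacobian_forms :: "'a::field poly3 \<Rightarrow> nat \<Rightarrow> 'a poly3 set" where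
  "local_jacobian_forms F n = {P. homogeneous n P \<and> at_Z P \<in> local_tjurina_ideal (at_Z F)}"

lemma local_tjurina_ideal_add:
  assumes "g \<in> local_tjurina_ideal f" "h \<in> local_tjurina_ideal f"
  shows "g + h \<in> local_tjurina_ideal f"
  using assms local_ring.ideal_closed(3)[OF ideal_local_tjurina_fract[of f]]
  unfolding to_fract_in_local_tjurina_fract_iff[symmetric] to_fract_add by blast

lemma subspace_local_jacobian_forms: "poly3.subspace (local_jacobian_forms F n)"
  unfolding local_jacobian_forms_def
  using tjurina_ideal_generators(1)[of "at_Z F", THEN tjurina_ideal_mult, of 0, THEN local_tjurina_ideal_superset]
  by (intro poly3.subspaceI)
    (auto simp: at_Z_simps at_Z_scale3 simp del: mult_pCons_left
      intro!: homogeneous_add homogeneous_scale3 local_tjurina_ideal_add local_tjurina_ideal_mult)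

text \<open>
  A polynomial basis of the local Tjurina algebra can be homogenized to every large degree.
\<close>

lemma codimension_local_jacobian_forms_ge:
  fixes F :: "'a::field poly3"
  assumes "local_tjurina (at_Z F) = enat \<tau>"
  shows "\<exists>n0. \<forall>n\<ge>n0. \<exists>b. b ` {..<\<tau>} \<subseteq> {P. homogeneous n P} \<and>
    poly3.family_independent_mod (local_jacobian_forms F n) {..<\<tau>} b"
proof -
  obtain g where g: "\<And>c. (\<Sum>i<\<tau>. const2 (c i) * g i) \<in> local_tjurina_ideal (at_Z F) \<Longrightarrow> \<forall>i<\<tau>. c i = 0"
    using local_tjurina_basis[OF assms] by blast
  have "eventually (\<lambda>n. \<forall>i\<in>{..<\<tau>}. \<exists>P. homogeneous n P \<and> at_Z P = g i) sequentially"
    using chart_Z.homogenization by (intro eventually_ball_finite) (auto simp: eventually_sequentially)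
  then obtain n0 where n0: "\<And>n i. n \<ge> n0 \<Longrightarrow> i < \<tau> \<Longrightarrow> \<exists>P. homogeneous n P \<and> at_Z P = g i"
    by (auto simp: eventually_sequentially)
  have "\<exists>b. b ` {..<\<tau>} \<subseteq> {P. homogeneous n P} \<and>
    poly3.family_independent_mod (local_jacobian_forms F n) {..<\<tau>} b" if n: "n \<ge> n0" for n
  proof -
    obtain b where b: "\<And>i. i < \<tau> \<Longrightarrow> homogeneous n (b i) \<and> at_Z (b i) = g i"
      using n0[OF n] by metis
    have "\<forall>i\<in>{..<\<tau>}. c i = 0" if "(\<Sum>i<\<tau>. scale3 (c i) (b i)) \<in> local_jacobian_forms F n" for c
    proof -
      have "at_Z (\<Sum>i<\<tau>. scale3 (c i) (b i)) \<in> local_tjurina_ideal (at_Z F)"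
        using that by (simp add: local_jacobian_forms_def)
      moreover have "at_Z (\<Sum>i<\<tau>. scale3 (c i) (b i)) = (\<Sum>i<\<tau>. const2 (c i) * g i)"
        unfolding at_Z_sum_scale3 by (intro sum.cong) (simp_all add: b)
      ultimately show ?thesis using g[of c] by simp
    qed
    then show ?thesis using b
      by (intro exI[of _ b]) (auto simp: poly3.family_independent_mod_def)
  qed
  then show ?thesis by blast
qed


text \<open>
  The comparison of the two fields in one large degree \<open>n\<close>. It yields the equality of
  \<open>jacobian_forms\<close> and \<open>local_jacobian_forms\<close> over the rationals, of which only the powers of the
  variables are kept.
\<close>

lemma power_var_in_rational_jacobian_forms:
  fixes G :: "int poly3"
  defines "F \<equiv> map_coeffs of_int G :: rat poly3" and "Fq \<equiv> map_coeffs of_int G :: 'k::field poly3"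
  assumes hom: "homogeneous d F" and d: "d > 0"
    and q: "prime q" "card (UNIV :: 'k set) = q"
    and tau: "local_tjurina (at_Z Fq) = local_tjurina (at_Z F)"
    and charts: "tjurina_X_nonzero Fq = 0" "tjurina_Y_nonzero Fq = 0"
  shows "\<exists>n. varX ^ n \<in> jacobian_forms d F n \<and> varY ^ n \<in> jacobian_forms d F n"
proof -
  have "homogeneous d G"
    using hom unfolding F_def homogeneous_def by (simp add: coeff3_map_coeffs)
  then have hom_q: "homogeneous d Fq"
    unfolding Fq_def by (intro homogeneous_map_coeffs) simp
  obtain N where N: "varX ^ N \<in> jacobian_forms d Fq N" "varY ^ N \<in> jacobian_forms d Fq N"
    using power_X_in_jacobian_forms[OF hom_q d charts(1)] power_Y_in_jacobian_forms[OF hom_q d charts(2)]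
      power_var_in_jacobian_forms_mono by metis
  have "coord_x ^ N \<in> tjurina_ideal (at_Z Fq)" "coord_y ^ N \<in> tjurina_ideal (at_Z Fq)"
    using N[THEN at_Z_jacobian_forms[OF hom_q]] by (simp_all only: at_Z_simps at_Z_var)
  then have "local_tjurina (at_Z Fq) \<noteq> \<infinity>" by (rule local_tjurina_finite)
  then obtain \<tau> where \<tau>q: "local_tjurina (at_Z Fq) = enat \<tau>" by blast
  then have \<tau>: "local_tjurina (at_Z F) = enat \<tau>" using tau by simp
  obtain n1 where n1: "\<And>n D. n \<ge> n1 \<Longrightarrow> D \<subseteq> {P. homogeneous n P} \<Longrightarrow>
    poly3.family_independent_mod (jacobian_forms d Fq n) D (\<lambda>P. P) \<Longrightarrow> card D \<le> \<tau>"
    using codimension_jacobian_forms_le[OF hom_q d N \<tau>q] by blast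
  obtain n2 where n2: "\<And>n. n \<ge> n2 \<Longrightarrow> \<exists>b. b ` {..<\<tau>} \<subseteq> {P. homogeneous n P} \<and>
    poly3.family_independent_mod (local_jacobian_forms F n) {..<\<tau>} b"
    using codimension_local_jacobian_forms_ge[OF \<tau>] by blast
  define n where "n = n1 + n2 + d + \<tau>"
  have n: "n \<ge> n1" "n \<ge> n2" "d \<le> n" "\<tau> \<le> n" by (auto simp: n_def)
  obtain C D where C: "C \<subseteq> jacobian_forms d Fq n" "finite C" "poly3.independent C"
    and D: "D \<subseteq> {P. homogeneous n P}" "poly3.family_independent_mod (jacobian_forms d Fq n) D (\<lambda>P. P)"
    and card: "card (monomials n :: 'k poly3 set) \<le> card C + card D"
    using poly3.basis_with_complement[OF subspace_jacobian_forms[OF n(3), of Fq]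
        jacobian_forms_homogeneous[OF hom_q d] monomials_homogeneous independent_monomials
        finite_monomials homogeneous_in_span] by blast
  obtain C' where C': "C' \<subseteq> jacobian_forms d F n" "poly3.independent C'" "card C' = card C"
    using independent_jacobian_forms_lift[OF q C(1)[unfolded Fq_def] C(2,3)] unfolding F_def by blast
  obtain b where b: "b ` {..<\<tau>} \<subseteq> {P. homogeneous n P}"
    "poly3.family_independent_mod (local_jacobian_forms F n) {..<\<tau>} b"
    using n2[OF n(2)] by blast
  have J_sub: "jacobian_forms d F n \<subseteq> local_jacobian_forms F n"
    using at_Z_jacobian_forms[OF hom] jacobian_forms_homogeneous[OF hom d]
    by (auto simp: local_jacobian_forms_def intro: local_tjurina_ideal_superset)
  have "card (monomials n :: rat poly3 set) \<le> card C' + card {..<\<tau>}"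
    using card n1[OF n(1) D] C'(3) by (simp add: card_monomials)
  then have "local_jacobian_forms F n \<subseteq> poly3.span C'"
    using C'(1) J_sub
    by (intro poly3.codimension_squeeze[OF subspace_local_jacobian_forms _ homogeneous_in_span
          finite_monomials _ C'(2) b(2,1)])
      (auto simp: local_jacobian_forms_def)
  also have "\<dots> \<subseteq> jacobian_forms d F n"
    by (rule poly3.span_minimal[OF C'(1) subspace_jacobian_forms[OF n(3)]])
  finally have sub: "local_jacobian_forms F n \<subseteq> jacobian_forms d F n" .
  have pow: "z ^ n \<in> local_tjurina_ideal (at_Z F)" if "value_at_origin z = 0" for z
    using local_tjurina_ideal_mult[OF power_in_local_tjurina_ideal[OF \<tau> that], of "z ^ (n - \<tau>)"] n(4)
    by (simp flip: power_add)
  have "varX ^ n \<in> local_jacobian_forms F n" "varY ^ n \<in> local_jacobian_forms F n"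
    using pow[OF value_at_origin_coord(1)] pow[OF value_at_origin_coord(2)]
    unfolding local_jacobian_forms_def mem_Collect_eq at_Z_simps at_Z_var
    by (simp_all add: var_power homogeneous_mono3)
  then show ?thesis using sub by blast
qed

section \<open>Points of the projective plane\<close>

lemma polyring3_eq: "polyring3 = ring_on UNIV"
  by (simp add: polyring3_def ring_on_UNIV)

lemma ideal_polyring3_closed:
  assumes "ideal I polyring3"
  shows "0 \<in> I" "x \<in> I \<Longrightarrow> y \<in> I \<Longrightarrow> x + y \<in> I" "x \<in> I \<Longrightarrow> a * x \<in> I"
    "x \<in> I \<Longrightarrow> y \<in> I \<Longrightarrow> x - y \<in> I"
  using type_ring.ideal_closed[OF assms[unfolded polyring3_eq]] by auto

lemma genideal_polyring3_ideal: "ideal (genideal polyring3 S) polyring3"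
  unfolding polyring3_eq by (rule type_ring.genideal_ideal) simp

lemma genideal_polyring3_self: "S \<subseteq> genideal polyring3 S"
  unfolding polyring3_eq by (rule type_ring.genideal_self) simp

lemma genideal_polyring3_minimal: "ideal I polyring3 \<Longrightarrow> S \<subseteq> I \<Longrightarrow> genideal polyring3 S \<subseteq> I"
  unfolding polyring3_eq by (rule type_ring.genideal_minimal)

text \<open>
  Reduction modulo \<open>\<langle>X, Y\<rangle>\<close>, with values in the polynomials in \<open>Z\<close>. Since these form a domain, its
  kernel \<open>point_P\<close> is prime.
\<close>

definition on_Z_axis :: "'a::comm_ring_1 poly3 \<Rightarrow> 'a poly" where
  "on_Z_axis = map_poly value_at_origin"

lemma is_ring_hom_on_Z_axis: "is_ring_hom on_Z_axis"
  unfolding on_Z_axis_def by (rule is_ring_hom_map_poly[OF value_at_origin_hom])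

lemmas on_Z_axis_simps = is_ring_hom_sel[OF is_ring_hom_on_Z_axis]

lemma on_Z_axis_var: "on_Z_axis varX = 0" "on_Z_axis varY = 0" "on_Z_axis varZ = [:0, 1:]"
  by (simp_all add: on_Z_axis_def varX_def varY_def varZ_def map_poly_pCons)

text \<open>
  The induction peels off the powers of \<open>Z\<close> and splits each coefficient in \<open>X\<close> and \<open>Y\<close> by
  \<open>origin_decomposition\<close>.
\<close>

lemma on_Z_axis_decomposition:
  fixes P :: "'a::comm_ring_1 poly3"
  shows "\<exists>A B. P = map_poly const2 (on_Z_axis P) + A * varX + B * varY"
proof (induction P)
  case 0
  show ?case by (intro exI[of _ 0]) (simp add: on_Z_axis_def)
next
  case (pCons p P)
  then obtain A B where AB: "P = map_poly const2 (on_Z_axis P) + A * varX + B * varY" by blast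
  obtain a b where ab: "p = const2 (value_at_origin p) + coord_x * a + coord_y * b"
    using origin_decomposition by blast
  have "pCons p P = [:p:] + varZ * P" by (simp add: varZ_def)
  also have "\<dots> = [:const2 (value_at_origin p):] + [:coord_x * a:] + [:coord_y * b:]
    + varZ * (map_poly const2 (on_Z_axis P) + A * varX + B * varY)"
    by (subst ab, subst AB) (simp del: mult_pCons_left mult_pCons_right)
  also have "[:coord_x * a:] = [:a:] * varX" by (simp add: varX_def mult.commute)
  also have "[:coord_y * b:] = [:b:] * varY" by (simp add: varY_def mult.commute)
  also have "[:const2 (value_at_origin p):] + [:a:] * varX + [:b:] * varY
    + varZ * (map_poly const2 (on_Z_axis P) + A * varX + B * varY)
    = ([:const2 (value_at_origin p):] + varZ * map_poly const2 (on_Z_axis P))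
      + ([:a:] + varZ * A) * varX + ([:b:] + varZ * B) * varY"
    by (simp only: algebra_simps)
  also have "[:const2 (value_at_origin p):] + varZ * map_poly const2 (on_Z_axis P)
    = map_poly const2 (on_Z_axis (pCons p P))"
    by (simp add: on_Z_axis_def map_poly_pCons varZ_def)
  finally show ?case by blast
qed

lemma point_P_ideal: "ideal point_P polyring3"
  unfolding point_P_def by (rule genideal_polyring3_ideal)

lemma point_P_eq: "point_P = {P. on_Z_axis P = 0}"
proof
  have "ideal {P. on_Z_axis P = 0} (polyring3 :: 'a poly3 ring)"
    unfolding polyring3_eq by (rule type_ring.ideal_ring_onI) (auto simp: on_Z_axis_simps)
  then show "point_P \<subseteq> {P :: 'a poly3. on_Z_axis P = 0}"
    unfolding point_P_def by (rule genideal_polyring3_minimal) (auto simp: on_Z_axis_var)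
next
  have var: "varX \<in> (point_P :: 'a poly3 set)" "varY \<in> (point_P :: 'a poly3 set)"
    using genideal_polyring3_self[of "{varX, varY :: 'a poly3}"] unfolding point_P_def by auto
  show "{P :: 'a poly3. on_Z_axis P = 0} \<subseteq> point_P"
  proof clarify
    fix P :: "'a poly3" assume "on_Z_axis P = 0"
    then obtain A B where "P = A * varX + B * varY" using on_Z_axis_decomposition[of P] by auto
    then show "P \<in> point_P"
      using ideal_polyring3_closed(2,3)[OF point_P_ideal] var by metis
  qed
qed

lemma on_Z_axis_homogeneous:
  assumes "homogeneous n P" shows "on_Z_axis P = monom (coeff3 P 0 0 n) n"
proof (rule poly_eqI)
  fix k
  show "coeff (on_Z_axis P) k = coeff (monom (coeff3 P 0 0 n) n) k"
    using homogeneous_coeff[OF assms, of 0 0 k]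
    by (auto simp: on_Z_axis_def coeff_map_poly value_at_origin_def poly_0_coeff_0)
qed

lemma homogeneous_in_point_P_iff:
  assumes "homogeneous n P" shows "P \<in> point_P \<longleftrightarrow> value_at_origin (at_Z P) = 0"
proof -
  have "coeff3 P 0 0 k = 0" if "k \<noteq> n" for k using homogeneous_coeff[OF assms] that by simp
  then have "value_at_origin (at_Z P) = coeff3 P 0 0 n"
    unfolding at_Z_def
    by (subst additive_poly_1_eq_coeff[of value_at_origin n]) (auto simp: value_at_origin_def poly_0_coeff_0)
  then show ?thesis by (simp add: point_P_eq on_Z_axis_homogeneous[OF assms] monom_eq_0_iff)
qed

lemma homogeneous_ideal_point_P: "homogeneous_ideal point_P"
proof -
  let ?S = "{a \<in> point_P. \<exists>d. homogeneous d a} :: 'a poly3 set"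
  have "homogeneous 1 (varX :: 'a poly3)" "homogeneous 1 (varY :: 'a poly3)"
    by (simp_all add: var_eq_mono3 homogeneous_mono3)
  then have "{varX, varY} \<subseteq> ?S" by (auto simp: point_P_eq on_Z_axis_var)
  then have "point_P \<subseteq> genideal polyring3 ?S"
    using genideal_polyring3_self[of ?S] unfolding point_P_def
    by (intro genideal_polyring3_minimal genideal_polyring3_ideal) blast
  moreover have "genideal polyring3 ?S \<subseteq> point_P"
    by (rule genideal_polyring3_minimal[OF point_P_ideal]) blast
  ultimately show ?thesis using point_P_ideal by (auto simp: homogeneous_ideal_def)
qed

lemma primeideal_point_P: "primeideal point_P polyring3"
proof (rule primeidealI)
  show "ideal point_P polyring3" by (rule point_P_ideal)
  show "cring polyring3" unfolding polyring3_eq by (rule type_ring.cring_ring_on)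
  have "1 \<notin> point_P" by (simp add: point_P_eq on_Z_axis_simps)
  then show "carrier polyring3 \<noteq> point_P" unfolding polyring3_eq by auto
qed (auto simp: polyring3_eq point_P_eq on_Z_axis_simps)

lemma primeideal_power:
  assumes "primeideal I polyring3" "x ^ n \<in> I" shows "x \<in> I"
proof -
  interpret I: primeideal I polyring3 by fact
  have "1 \<notin> I"
    using I.one_imp_carrier I.I_notcarr by (auto simp: polyring3_eq)
  moreover have "x \<in> I \<or> x ^ m \<in> I" if "x ^ Suc m \<in> I" for m
    using I.I_prime[of x "x ^ m"] that by (simp add: polyring3_eq)
  ultimately show ?thesis using assms(2) by (induction n) auto
qed

lemma point_P_in_singular_locus:
  assumes "homogeneous d F" "d > 0" "tjurina_P F > 0"
  shows "point_P \<in> singular_locus F"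
proof -
  have pos: "local_tjurina (at_Z F) > 0" using assms(3) by (simp add: tjurina_P_def at_Z_def)
  obtain d' where d: "d = Suc d'" using assms(2) by (cases d) auto
  note hom = homogeneous_partial[OF assms(1)[unfolded d]]
  have "{partialX F, partialY F, partialZ F} \<subseteq> point_P"
    using at_Z_partials_in_tjurina_ideal[OF assms(1)] hom[THEN homogeneous_in_point_P_iff]
      value_at_origin_eq_0_if_local_tjurina_pos[OF pos] by auto
  then have "genideal polyring3 {partialX F, partialY F, partialZ F} \<subseteq> point_P"
    by (rule genideal_polyring3_minimal[OF point_P_ideal])
  moreover have "varZ \<notin> point_P" by (simp add: point_P_eq on_Z_axis_var)
  then have "\<not> genideal polyring3 {varX, varY, varZ} \<subseteq> point_P"
    using genideal_polyring3_self[of "{varX, varY, varZ}"] by auto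
  ultimately show ?thesis
    using primeideal_point_P homogeneous_ideal_point_P by (simp add: singular_locus_def Proj_quot_def)
qed

text \<open>
  \<open>I\<close> is generated by its homogeneous elements. Modulo \<open>\<langle>X, Y\<rangle>\<close> such an element is \<open>c Z^n\<close>; if \<open>c\<close>
  were not zero, then \<open>Z\<close> would lie in \<open>I\<close>, which therefore would contain the irrelevant ideal.
\<close>

lemma homogeneous_primeideal_eq_point_P:
  assumes prime: "primeideal I polyring3" and hom: "homogeneous_ideal I"
    and X: "varX \<in> I" and Y: "varY \<in> I"
    and proper: "\<not> genideal polyring3 {varX, varY, varZ} \<subseteq> I"
  shows "I = point_P"
proof
  have ideal: "ideal I polyring3" using prime by (rule primeideal.axioms)
  show sub: "point_P \<subseteq> I"
    unfolding point_P_def by (rule genideal_polyring3_minimal[OF ideal]) (use X Y in simp)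
  have Z: "varZ \<notin> I"
    using proper X Y genideal_polyring3_minimal[OF ideal, of "{varX, varY, varZ}"] by auto
  have "a \<in> point_P" if a: "a \<in> I" "homogeneous n a" for a n
  proof (rule ccontr)
    let ?c = "coeff3 a 0 0 n"
    assume "a \<notin> point_P"
    then have c: "?c \<noteq> 0" by (auto simp: point_P_eq on_Z_axis_homogeneous[OF a(2)])
    have "on_Z_axis (scale3 ?c (varZ ^ n)) = on_Z_axis a"
      unfolding on_Z_axis_homogeneous[OF a(2)] var_power
      by (subst on_Z_axis_homogeneous[of n]) (auto simp: coeff3_mono3 intro!: homogeneous_scale3 homogeneous_mono3)
    then have "a - scale3 ?c (varZ ^ n) \<in> I"
      using sub by (auto simp: point_P_eq on_Z_axis_simps)
    then have "a - (a - scale3 ?c (varZ ^ n)) \<in> I"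
      by (rule ideal_polyring3_closed(4)[OF ideal a(1)])
    then have "scale3 ?c (varZ ^ n) \<in> I" by simp
    then have "scale3 (inverse ?c) (scale3 ?c (varZ ^ n)) \<in> I"
      unfolding scale3_def[of "inverse ?c"] by (rule ideal_polyring3_closed(3)[OF ideal])
    then have "varZ ^ n \<in> I" using c by (simp only: poly3.scale_scale) simp
    then show False using primeideal_power[OF prime] Z by blast
  qed
  then have "genideal polyring3 {a \<in> I. \<exists>d. homogeneous d a} \<subseteq> point_P"
    by (intro genideal_polyring3_minimal[OF point_P_ideal]) blast
  then show "I \<subseteq> point_P" using hom unfolding homogeneous_ideal_def by metis
qed

text \<open>
  Over the rationals \<open>d\<close> is invertible, so by Euler's identity the ideal of the partial derivatives
  contains \<open>F\<close> and hence all of \<open>jacobian_forms\<close>.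
\<close>

theorem proposition18:
  fixes F :: "rat poly3" and G :: "int poly3" and Fq :: "'k::field poly3"
    and d q :: nat
  assumes "squarefree F"
    and "homogeneous d F" and "d > 0"
    and "F = map_coeffs of_int G"
    and "prime q" and "card (UNIV :: 'k set) = q"
    and "Fq = map_coeffs of_int G" and "Fq \<noteq> 0"
    and "tjurina_P Fq = tjurina_P F" and "tjurina_P F > 0"
    and "tjurina_X_nonzero Fq = 0" and "tjurina_Y_nonzero Fq = 0"
  shows "singular_locus F = {point_P}"
proof
  show "{point_P} \<subseteq> singular_locus F"
    using point_P_in_singular_locus[OF assms(2,3,10)] by simp
next
  obtain n where n: "varX ^ n \<in> jacobian_forms d F n" "varY ^ n \<in> jacobian_forms d F n"
    using power_var_in_rational_jacobian_forms[of d G q, where 'k = 'k] assms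
    by (auto simp: tjurina_P_def at_Z_def)
  show "singular_locus F \<subseteq> {point_P}"
  proof
    fix I assume I: "I \<in> singular_locus F"
    then have prime: "primeideal I polyring3" and hom: "homogeneous_ideal I"
      and J: "genideal polyring3 {partialX F, partialY F, partialZ F} \<subseteq> I"
      and proper: "\<not> genideal polyring3 {varX, varY, varZ} \<subseteq> I"
      by (auto simp: singular_locus_def Proj_quot_def)
    note cl = ideal_polyring3_closed[OF primeideal.axioms(1)[OF prime]]
    have partials: "partialX F \<in> I" "partialY F \<in> I" "partialZ F \<in> I"
      using J genideal_polyring3_self[of "{partialX F, partialY F, partialZ F}"] by auto
    have "of_nat d * F \<in> I"
      unfolding euler_identity[OF assms(2), symmetric] by (intro cl(2,3) partials)
    then have "[:[:[:inverse (of_nat d):]:]:] * (of_nat d * F) \<in> I" by (rule cl(3))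
    also have "[:[:[:inverse (of_nat d):]:]:] * (of_nat d * F) = F"
      using assms(3) by (simp add: of_nat_poly flip: one_pCons)
    finally have "F \<in> I" .
    then have "P \<in> I" if "P \<in> jacobian_forms d F n" for P
      using that unfolding jacobian_forms_def by (auto intro!: cl(2,3) partials)
    then have "varX \<in> I" "varY \<in> I" using n primeideal_power[OF prime] by blast+
    then show "I \<in> {point_P}"
      using homogeneous_primeideal_eq_point_P[OF prime hom _ _ proper] by simp
  qed
qed

end
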